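(* Let $K$ be a compact Hausdorff space and $X$ a normed linear space. Let $\phi,\psi\in C(K,X)$ be non-zero and let $\delta,\varepsilon\in[0,1)$ with $\varepsilon<(1-\delta)^2$. Then $\phi\perp_\delta^\varepsilon\psi$ in $C(K,X)$ if and only if \[ \left\{\int_K\psi\,dm:\ m\in S_{(C(K,X))^*},\ \int_K\phi\,dm\ge(1-\delta)\|\phi\|_\infty\right\}\cap B\left(0,\frac{\varepsilon}{1-\delta}\|\psi\|_\infty\right)\ne\emptyset. \]
   Context: All normed linear spaces are over $\mathbb{C}$. $C(K,X)$ is the space of continuous functions $K\to X$ with the supremum norm $\|\cdot\|_\infty$. Its dual is identified isometrically with $\mathrm{rcabv}(K,X^* )$, the space of regular countably additive $X^*$-valued Borel measures $m$ of bounded variation on $K$ with norm $\|m\|=|m|(K)$ (total variation), via the pairing $m(\phi)=\int_K\phi\,dm$; here the integral of a simple function $\sum_i x_i\chi_{A_i}$ ($x_i\in X$, $A_i$ Borel) is $\sum_i m(A_i)(x_i)$, extended to $C(K,X)$ by uniform limits. $S_{(C(K,X))^*}$ is the unit sphere of this dual. An inequality such as $\int_K\phi\,dm\ge c$ with $c$ real includes the requirement that the left-hand side is real. $B(0,r)=\{z\in\mathbb{C}:|z|\le r\}$ for $r\ge0$ (so $B(0,0)=\{0\}$). For a normed linear space $Z$, $\delta,\varepsilon\in[0,1)$ with $\varepsilon<(1-\delta)^2$ and $u,v\in Z$, one writes $u\perp_\delta^\varepsilon v$ if there exists $f\in Z^*\setminus\{0\}$ with $|f(u)|\ge(1-\delta)\|f\|\|u\|$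 and $|f(v)|\le\frac{\varepsilon}{1-\delta}\|f\|\|v\|$. *)

theory Defs
  imports "HOL-Analysis.Analysis"
begin

section \<open>Complex normed spaces and their duals\<close>

text \<open>The library only has real normed spaces; as in the class of real normed vector spaces,
  completeness is not required.\<close>

class complex_normed_vector = real_normed_vector +
  fixes scaleC :: "complex \<Rightarrow> 'a \<Rightarrow> 'a" (infixr "*\<^sub>C" 75)
  assumes scaleC_add_right: "a *\<^sub>C (x + y) = a *\<^sub>C x + a *\<^sub>C y"
    and scaleC_add_left: "(a + b) *\<^sub>C x = a *\<^sub>C x + b *\<^sub>C x"
    and scaleC_scaleC: "a *\<^sub>C (b *\<^sub>C x) = (a * b) *\<^sub>C x"
    and scaleC_of_real: "of_real r *\<^sub>C x = r *\<^sub>R x"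
    and norm_scaleC: "norm (a *\<^sub>C x) = cmod a * norm x"

text \<open>For a complex-linear functional the norm of \<^typ>\<open>'a \<Rightarrow>\<^sub>L complex\<close>, which is the supremum of
  \<open>cmod (f x) / norm x\<close>, is its dual norm.\<close>

definition complex_dual :: "('a::complex_normed_vector \<Rightarrow>\<^sub>L complex) set" where
  "complex_dual = {f. \<forall>c x. blinfun_apply f (c *\<^sub>C x) = c * blinfun_apply f x}"

definition approx_orthogonal ::
    "real \<Rightarrow> real \<Rightarrow> 'a::complex_normed_vector \<Rightarrow> 'a \<Rightarrow> bool" where
  "approx_orthogonal \<delta> \<epsilon> u v \<longleftrightarrow>
     (\<exists>f \<in> complex_dual - {0}.
        cmod (blinfun_apply f u) \<ge> (1 - \<delta>) * norm f * norm u \<and>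
        cmod (blinfun_apply f v) \<le> \<epsilon> / (1 - \<delta>) * norm f * norm v)"

text \<open>If the domain type \<open>'k\<close> is compact, every continuous function on it is bounded, so that
  \<^typ>\<open>'k \<Rightarrow>\<^sub>C 'x\<close> with its supremum norm is the space \<open>C(K,X)\<close>.\<close>

instantiation bcontfun :: (topological_space, complex_normed_vector) complex_normed_vector
begin

definition scaleC_bcontfun :: "complex \<Rightarrow> ('a \<Rightarrow>\<^sub>C 'b) \<Rightarrow> 'a \<Rightarrow>\<^sub>C 'b" where
  "c *\<^sub>C f = Bcontfun (\<lambda>x. c *\<^sub>C apply_bcontfun f x)"

lemma apply_bcontfun_scaleC:
  "apply_bcontfun (c *\<^sub>C f) x = c *\<^sub>C apply_bcontfun f x" for f :: "'a \<Rightarrow>\<^sub>C 'b"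
proof -
  have "bounded_linear (\<lambda>y::'b. c *\<^sub>C y)"
  proof (rule bounded_linear_intro)
    show "c *\<^sub>C (r *\<^sub>R y) = r *\<^sub>R (c *\<^sub>C y)" for r and y :: 'b
      by (simp add: scaleC_scaleC mult.commute flip: scaleC_of_real)
    show "norm (c *\<^sub>C y) \<le> norm y * cmod c" for y :: 'b
      by (simp add: norm_scaleC)
  qed (rule scaleC_add_right)
  then have "continuous_on UNIV (\<lambda>x. c *\<^sub>C apply_bcontfun f x)"
    by (rule bounded_linear.continuous_on) simp
  moreover have "norm (c *\<^sub>C apply_bcontfun f x) \<le> cmod c * norm f" for x
    by (simp add: norm_scaleC mult_left_mono norm_bounded)
  ultimately have "(\<lambda>x. c *\<^sub>C apply_bcontfun f x) \<in> bcontfun"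
    by (rule bcontfun_normI)
  then show ?thesis
    by (simp add: scaleC_bcontfun_def Bcontfun_inverse)
qed

instance
proof
  fix a b :: complex and r :: real and f g :: "'a \<Rightarrow>\<^sub>C 'b"
  note eqI = bcontfun_eqI and app = apply_bcontfun_scaleC
  show "a *\<^sub>C (f + g) = a *\<^sub>C f + a *\<^sub>C g"
    by (rule eqI) (simp add: app scaleC_add_right)
  show "(a + b) *\<^sub>C f = a *\<^sub>C f + b *\<^sub>C f"
    by (rule eqI) (simp add: app scaleC_add_left)
  show assoc: "a *\<^sub>C (b *\<^sub>C f) = (a * b) *\<^sub>C f" for a b
    by (rule eqI) (simp add: app scaleC_scaleC)
  show real: "of_real r *\<^sub>C f = r *\<^sub>R f" for r
    by (rule eqI) (simp add: app scaleC_of_real)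
  have le: "norm (c *\<^sub>C h) \<le> cmod c * norm h" for c and h :: "'a \<Rightarrow>\<^sub>C 'b"
    by (rule norm_bound) (simp add: app norm_scaleC mult_left_mono norm_bounded)
  show "norm (a *\<^sub>C f) = cmod a * norm f"
  proof (cases "a = 0")
    case True
    then show ?thesis using real[of 0] by simp
  next
    case False
    then have "inverse a *\<^sub>C (a *\<^sub>C f) = f"
      using real[of 1] by (simp add: assoc)
    then have "norm f \<le> cmod (inverse a) * norm (a *\<^sub>C f)"
      by (metis le)
    with False have "cmod a * norm f \<le> norm (a *\<^sub>C f)"
      by (simp add: norm_inverse norm_divide field_simps)
    with le[of a f] show ?thesis by simp
  qed
qed

end


section \<open>Regular vector measures of bounded variation\<close>

text \<open>Measures are functions on all sets, of which only the values on Borel sets are used.\<close>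

definition variation ::
    "('k::topological_space set \<Rightarrow> 'e::real_normed_vector) \<Rightarrow> 'k set \<Rightarrow> ennreal" where
  "variation m A =
     (SUP P \<in> {P. finite P \<and> disjoint P \<and> P \<subseteq> sets borel \<and> \<Union>P = A}.
        \<Sum>B\<in>P. ennreal (norm (m B)))"

definition rcabv ::
    "('k::topological_space set \<Rightarrow> 'x::complex_normed_vector \<Rightarrow>\<^sub>L complex) set" where
  "rcabv = {m.
     (\<forall>A \<in> sets borel. m A \<in> complex_dual) \<and>
     (\<forall>A :: nat \<Rightarrow> 'k set. range A \<subseteq> sets borel \<longrightarrow> disjoint_family A \<longrightarrow>
        (\<lambda>i. m (A i)) sums m (\<Union>i. A i)) \<and>
     variation m UNIV < \<infinity> \<and>
     (\<forall>A \<in> sets borel. \<forall>e > 0. \<exists>C U. compact C \<and> open U \<and> C \<subseteq> A \<and> A \<subseteq> U \<and>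
        variation m (U - C) < ennreal e)}"

definition norm_rcabv ::
    "('k::topological_space set \<Rightarrow> 'x::complex_normed_vector \<Rightarrow>\<^sub>L complex) \<Rightarrow> real" where
  "norm_rcabv m = enn2real (variation m UNIV)"


section \<open>Integration of vector-valued functions against vector measures\<close>

text \<open>The sum runs over the finitely many values of \<open>s\<close>, i.e. it uses the canonical representation
  of \<open>s\<close> with pairwise distinct \<open>x\<close>; by additivity of \<open>m\<close> every other representation
  yields the same value.\<close>

definition simple_vintegral ::
    "('k::topological_space set \<Rightarrow> 'x::complex_normed_vector \<Rightarrow>\<^sub>L complex) \<Rightarrow> ('k \<Rightarrow> 'x) \<Rightarrow> complex"
  where "simple_vintegral m s = (\<Sum>x \<in> range s. blinfun_apply (m (s -` {x})) x)"

definition has_vintegral ::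
    "('k::topological_space set \<Rightarrow> 'x::complex_normed_vector \<Rightarrow>\<^sub>L complex) \<Rightarrow> ('k \<Rightarrow> 'x) \<Rightarrow> complex \<Rightarrow> bool"
  where "has_vintegral m f I \<longleftrightarrow>
     (\<exists>s :: nat \<Rightarrow> 'k \<Rightarrow> 'x. (\<forall>n. simple_function borel (s n)) \<and>
        uniform_limit UNIV s f sequentially \<and>
        (\<lambda>n. simple_vintegral m (s n)) \<longlonglongrightarrow> I)"

text \<open>For \<open>m\<close> in \<^const>\<open>rcabv\<close> and \<open>f\<close> continuous on a compact space, \<open>I\<close> exists and is unique, because
  \<open>f\<close> has totally bounded range and \<open>cmod (simple_vintegral m s) \<le> norm_rcabv m * (SUP t. norm (s t))\<close>.\<close>

definition vintegral ::
    "('k::topological_space set \<Rightarrow> 'x::complex_normed_vector \<Rightarrow>\<^sub>L complex) \<Rightarrow> ('k \<Rightarrow> 'x) \<Rightarrow> complex"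
  where "vintegral m f = (THE I. has_vintegral m f I)"

text \<open>The unit sphere of the dual of \<open>C(K,X)\<close> under its isometric identification with
  \<^const>\<open>rcabv\<close>.\<close>

definition dual_sphere ::
    "('k::topological_space set \<Rightarrow> 'x::complex_normed_vector \<Rightarrow>\<^sub>L complex) set" where
  "dual_sphere = {m \<in> rcabv. norm_rcabv m = 1}"

end

theory Submission
  imports Defs
begin

text \<open>A measure \<open>m\<close> in \<^const>\<open>rcabv\<close> acts on \<open>C(K,X)\<close> by integration, and the norm of this functional is
  the total variation of \<open>m\<close> (\<open>norm_vintegral_functional\<close>). Hence a measure in the set on the right
  hand side is itself a witness for approximate orthogonality: its functional has norm one.

  For the converse let \<open>f\<close> be a witness, normalised and rotated so that its norm is one and
  \<open>f \<phi> \<ge> 0\<close>. A measure is wanted that reproduces the two numbers \<open>f \<phi>\<close>, \<open>f \<psi>\<close> and the norm of \<open>f\<close>, and one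
  with finitely many atoms can be found
  (\<open>atomic_representation_norm_one\<close>). Two ideas carry this.

  First, on a finite-dimensional space of continuous functions, a functional of norm at most \<open>R\<close>
  is a convex combination of functionals \<open>\<omega> \<mapsto> x' (\<omega> t)\<close> with \<open>norm x' \<le> R\<close>
  (\<open>finite_combination_of_point_functionals\<close>). Indeed, in the finite-dimensional dual these
  point functionals form a compact set, because \<open>K\<close> is compact and, by the Hahn-Banach theorem, they are
  described by closed conditions; and no hyperplane separates \<open>f\<close> from their convex hull, because
  every continuous function attains its norm at some point, where it has a norming functional.
  A convex combination of this kind is an atomic measure of variation at most \<open>R\<close>.

  Second, the variation of such an atomic measure can be raised to exactly one without changing the
  integrals of \<open>\<phi>\<close> and \<open>\<psi>\<close>. If it is \<open>r < 1\<close>, then \<open>cmod (f \<theta>) > r * norm \<theta>\<close> for some \<open>\<theta>\<close>, so the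
  first measure does not represent \<open>f\<close> at \<open>\<theta>\<close>. A second atomic measure that represents \<open>f\<close> at \<open>\<phi>\<close>,
  \<open>\<psi>\<close> and \<open>\<theta>\<close> differs from it by a non-zero measure annihilating \<open>\<phi>\<close> and \<open>\<psi>\<close>. On the ray from the
  first measure through the second one the variation is continuous and unbounded, hence takes the
  value one.\<close>

section \<open>Additivity and variation of vector measures\<close>

lemma rcabv_sums:
  assumes "m \<in> rcabv" and "range A \<subseteq> sets borel" and "disjoint_family A"
  shows "(\<lambda>i::nat. m (A i)) sums m (\<Union>i. A i)"
proof -
  have "\<forall>A :: nat \<Rightarrow> _. range A \<subseteq> sets borel \<longrightarrow> disjoint_family A \<longrightarrow>
      (\<lambda>i. m (A i)) sums m (\<Union>i. A i)"
    using assms(1) unfolding rcabv_def mem_Collect_eq by (elim conjE)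
  from this[rule_format, OF assms(2,3)] show ?thesis .
qed

lemma rcabv_empty:
  assumes "m \<in> rcabv" shows "m {} = 0"
proof -
  have "(\<lambda>i::nat. m {}) sums m (\<Union>i::nat. {})"
    by (rule rcabv_sums[OF assms, of "\<lambda>_. {}"]) (auto simp: disjoint_family_on_def)
  then have "(\<lambda>i::nat. m {}) \<longlonglongrightarrow> 0"
    using summable_LIMSEQ_zero sums_summable by blast
  then show ?thesis
    by (simp add: LIMSEQ_const_iff)
qed

lemma rcabv_Un:
  assumes m: "m \<in> rcabv" and AB: "A \<in> sets borel" "B \<in> sets borel" "A \<inter> B = {}"
  shows "m (A \<union> B) = m A + m B"
proof -
  have "range (binaryset A B) \<subseteq> sets borel"
    using AB by (simp add: range_binaryset_eq)
  moreover have "disjoint_family (binaryset A B)"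
    using AB(3) by (auto simp: disjoint_family_on_def binaryset_def)
  ultimately have "(\<lambda>i. m (binaryset A B i)) sums m (\<Union>i. binaryset A B i)"
    by (rule rcabv_sums[OF m])
  moreover have "(\<lambda>i. m (binaryset A B i)) sums (m A + m B)"
    by (rule binaryset_sums) (rule rcabv_empty[OF m])
  ultimately show ?thesis
    by (metis UN_binaryset_eq sums_unique2)
qed

lemma rcabv_UN:
  assumes m: "m \<in> rcabv" and "finite I"
    and "\<And>i. i \<in> I \<Longrightarrow> S i \<in> sets borel" and "disjoint_family_on S I"
  shows "m (\<Union>i\<in>I. S i) = (\<Sum>i\<in>I. m (S i))"
  using assms(2-)
proof (induction I)
  case empty
  show ?case by (simp add: rcabv_empty[OF m])
next
  case (insert i I)
  have S: "S j \<in> sets borel" if "j \<in> I" for j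
    using insert.prems(1) that by simp
  have "S i \<inter> (\<Union>j\<in>I. S j) = {}"
    using insert.prems(2) insert.hyps(2) by (auto simp: disjoint_family_on_def)
  then have "m (S i \<union> (\<Union>j\<in>I. S j)) = m (S i) + m (\<Union>j\<in>I. S j)"
    using insert.prems(1) insert.hyps(1) S by (intro rcabv_Un[OF m] sets.finite_UN) auto
  moreover have "disjoint_family_on S I"
    using insert.prems(2) by (auto simp: disjoint_family_on_def)
  then have "m (\<Union>j\<in>I. S j) = (\<Sum>j\<in>I. m (S j))"
    using S by (rule insert.IH[rotated])
  ultimately show ?case
    using insert.hyps by simp
qed

text \<open>The variation is a supremum over partitions of \<open>A\<close> into distinct sets. An indexed family may repeat
  the empty set, which contributes nothing since \<open>m {} = 0\<close>, and may leave part of \<open>A\<close> uncovered, which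
  is then added as one more piece.\<close>

lemma sum_norm_le_variation:
  assumes m0: "m {} = 0" and I: "finite I" "\<And>i. i \<in> I \<Longrightarrow> S i \<in> sets borel"
    and disj: "disjoint_family_on S I"
    and sub: "(\<Union>i\<in>I. S i) \<subseteq> A" and A: "A \<in> sets borel"
  shows "(\<Sum>i\<in>I. ennreal (norm (m (S i)))) \<le> variation m A"
proof -
  define D where "D = A - (\<Union>i\<in>I. S i)"
  define P where "P = insert D (S ` I)"
  have D: "D \<in> sets borel"
    unfolding D_def using I A by auto
  have "S i \<inter> S j = {}" if "i \<in> I" "j \<in> I" "S i \<noteq> S j" for i j
    using disj that unfolding disjoint_family_on_def by metis
  then have "disjoint P"
    unfolding P_def D_def disjoint_def by auto
  then have P: "P \<in> {P. finite P \<and> disjoint P \<and> P \<subseteq> sets borel \<and> \<Union>P = A}"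
    using I D sub unfolding P_def by (auto simp: D_def)
  have "(\<Sum>i\<in>I. ennreal (norm (m (S i)))) = (\<Sum>B\<in>S ` I. ennreal (norm (m B)))"
  proof (rule sum.reindex_nontrivial[symmetric, unfolded o_def])
    fix i j assume "i \<in> I" "j \<in> I" "i \<noteq> j" "S i = S j"
    then have "S i = {}"
      using disj by (auto simp: disjoint_family_on_def)
    then show "ennreal (norm (m (S i))) = 0"
      by (simp add: m0)
  qed (use I in auto)
  also have "\<dots> \<le> (\<Sum>B\<in>P. ennreal (norm (m B)))"
    unfolding P_def using I by (intro sum_mono2) auto
  also have "\<dots> \<le> variation m A"
    unfolding variation_def using P by (rule SUP_upper)
  finally show ?thesis .
qed

lemma variation_mono:
  assumes m0: "m {} = 0" and "A \<subseteq> B" "B \<in> sets borel"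
  shows "variation m A \<le> variation m B"
  unfolding variation_def[of m A]
proof (rule SUP_least)
  fix P assume P: "P \<in> {P. finite P \<and> disjoint P \<and> P \<subseteq> sets borel \<and> \<Union>P = A}"
  have "disjoint_family_on (\<lambda>B. B) P"
    using P by (auto simp: disjoint_def disjoint_family_on_def)
  then show "(\<Sum>B\<in>P. ennreal (norm (m B))) \<le> variation m B"
    using P assms by (intro sum_norm_le_variation[of m, OF m0]) auto
qed

lemma variation_UN_le:
  assumes m: "m \<in> rcabv" and I: "finite I" "\<And>i. i \<in> I \<Longrightarrow> S i \<in> sets borel"
    and disj: "disjoint_family_on S I"
  shows "variation m (\<Union>i\<in>I. S i) \<le> (\<Sum>i\<in>I. variation m (S i))"
  unfolding variation_def[of m "\<Union>i\<in>I. S i"]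
proof (rule SUP_least)
  fix P assume "P \<in> {P. finite P \<and> disjoint P \<and> P \<subseteq> sets borel \<and> \<Union>P = (\<Union>i\<in>I. S i)}"
  then have P: "finite P" "disjoint P" "\<And>B. B \<in> P \<Longrightarrow> B \<in> sets borel"
    and UP: "\<Union>P = (\<Union>i\<in>I. S i)" by auto
  have "ennreal (norm (m B)) \<le> (\<Sum>i\<in>I. ennreal (norm (m (B \<inter> S i))))" if B: "B \<in> P" for B
  proof -
    have "B = (\<Union>i\<in>I. B \<inter> S i)"
      using B UP by auto
    moreover have "disjoint_family_on (\<lambda>i. B \<inter> S i) I"
      using disj by (auto simp: disjoint_family_on_def)
    ultimately have "m B = (\<Sum>i\<in>I. m (B \<inter> S i))"
      using rcabv_UN[OF m, of I "\<lambda>i. B \<inter> S i"] I P(3)[OF B] by auto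
    then show ?thesis
      using norm_sum[of "\<lambda>i. m (B \<inter> S i)" I] by (simp add: ennreal_leI)
  qed
  then have "(\<Sum>B\<in>P. ennreal (norm (m B))) \<le> (\<Sum>B\<in>P. \<Sum>i\<in>I. ennreal (norm (m (B \<inter> S i))))"
    by (rule sum_mono)
  also have "\<dots> = (\<Sum>i\<in>I. \<Sum>B\<in>P. ennreal (norm (m (B \<inter> S i))))"
    by (rule sum.swap)
  also have "\<dots> \<le> (\<Sum>i\<in>I. variation m (S i))"
  proof (rule sum_mono)
    fix i assume "i \<in> I"
    have "disjoint_family_on (\<lambda>B. B \<inter> S i) P"
      using P(2) by (auto simp: disjoint_def disjoint_family_on_def)
    with P I \<open>i \<in> I\<close> show "(\<Sum>B\<in>P. ennreal (norm (m (B \<inter> S i)))) \<le> variation m (S i)"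
      by (intro sum_norm_le_variation rcabv_empty[OF m]) auto
  qed
  finally show "(\<Sum>B\<in>P. ennreal (norm (m B))) \<le> (\<Sum>i\<in>I. variation m (S i))" .
qed

definition real_variation ::
    "('k::topological_space set \<Rightarrow> 'e::real_normed_vector) \<Rightarrow> 'k set \<Rightarrow> real" where
  "real_variation m A = enn2real (variation m A)"

lemma ennreal_real_variation:
  assumes "m \<in> rcabv"
  shows "ennreal (real_variation m A) = variation m A"
proof -
  have "variation m A \<le> variation m UNIV"
    by (rule variation_mono) (use rcabv_empty[OF assms] in auto)
  also have "\<dots> < \<infinity>" using assms by (simp add: rcabv_def)
  finally show ?thesis unfolding real_variation_def by simp
qed

lemma real_variation_nonneg [simp]: "0 \<le> real_variation m A"
  by (simp add: real_variation_def)

lemma sum_norm_le_real_variation: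
  assumes m: "m \<in> rcabv" and "finite I" "\<And>i. i \<in> I \<Longrightarrow> S i \<in> sets borel"
    and "disjoint_family_on S I" and "(\<Union>i\<in>I. S i) \<subseteq> A" and "A \<in> sets borel"
  shows "(\<Sum>i\<in>I. norm (m (S i))) \<le> real_variation m A"
proof -
  have "(\<Sum>i\<in>I. ennreal (norm (m (S i)))) \<le> ennreal (real_variation m A)"
    unfolding ennreal_real_variation[OF m]
    using assms rcabv_empty[OF m] by (intro sum_norm_le_variation) auto
  then show ?thesis by simp
qed

lemma real_variation_UN_le:
  assumes m: "m \<in> rcabv" and I: "finite I" "\<And>i. i \<in> I \<Longrightarrow> S i \<in> sets borel"
    and disj: "disjoint_family_on S I"
  shows "real_variation m (\<Union>i\<in>I. S i) \<le> (\<Sum>i\<in>I. real_variation m (S i))"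
  using variation_UN_le[OF assms]
  by (simp add: ennreal_real_variation[OF m, symmetric] sum_nonneg)

section \<open>Integration against a vector measure\<close>

text \<open>The integral of a simple function can be computed from any finite measurable partition on whose
  pieces \<open>p -` {j}\<close> the function is constant. Taking for \<open>p\<close> a pair of simple functions gives their
  common refinement, which is how additivity and the norm estimate are obtained.\<close>

lemma simple_vintegral_compose:
  assumes m: "m \<in> rcabv" and p: "simple_function borel p" and J: "finite J" "range p \<subseteq> J"
  shows "simple_vintegral m (\<lambda>t. g (p t)) = (\<Sum>j\<in>J. m (p -` {j}) (g j))"
proof -
  have pb: "p -` {j} \<in> sets borel" for j
    using simple_functionD(2)[OF p, of "{j}"] by simp
  have level: "m ((\<lambda>t. g (p t)) -` {x}) = (\<Sum>j\<in>{j\<in>J. g j = x}. m (p -` {j}))" for x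
  proof -
    have "(\<lambda>t. g (p t)) -` {x} = (\<Union>j\<in>{j\<in>J. g j = x}. p -` {j})"
      using J by auto
    then show ?thesis
      using rcabv_UN[OF m, of "{j\<in>J. g j = x}" "\<lambda>j. p -` {j}"] J pb
      by (auto simp: disjoint_family_on_def)
  qed
  have zero: "m ((\<lambda>t. g (p t)) -` {x}) = 0" if "x \<notin> range (\<lambda>t. g (p t))" for x
  proof -
    have "(\<lambda>t. g (p t)) -` {x} = {}" using that by auto
    then show ?thesis by (simp add: rcabv_empty[OF m])
  qed
  have "simple_vintegral m (\<lambda>t. g (p t)) = (\<Sum>x\<in>g ` J. m ((\<lambda>t. g (p t)) -` {x}) x)"
    unfolding simple_vintegral_def
    using J zero by (intro sum.mono_neutral_left) auto
  also have "\<dots> = (\<Sum>x\<in>g ` J. \<Sum>j\<in>{j\<in>J. g j = x}. m (p -` {j}) (g j))"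
    unfolding level by (simp add: blinfun.sum_left)
  also have "\<dots> = (\<Sum>j\<in>J. m (p -` {j}) (g j))"
    using J by (intro sum.group) auto
  finally show ?thesis .
qed

lemma simple_vintegral_add:
  assumes m: "m \<in> rcabv" and s: "simple_function borel s" "simple_function borel u"
  shows "simple_vintegral m (\<lambda>t. s t + u t) = simple_vintegral m s + simple_vintegral m u"
proof -
  define p where "p = (\<lambda>t. (s t, u t))"
  have p: "simple_function borel p"
    unfolding p_def using s by (rule simple_function_Pair)
  then have J: "finite (range p)" "range p \<subseteq> range p"
    by (auto simp: simple_function_def)
  note c = simple_vintegral_compose[OF m p J]
  show ?thesis
    using c[of "\<lambda>q. fst q + snd q"] c[of fst] c[of snd]
    by (simp add: p_def blinfun.add_right sum.distrib)
qed

lemma simple_vintegral_scaleC: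
  assumes m: "m \<in> rcabv" and s: "simple_function borel s"
  shows "simple_vintegral m (\<lambda>t. c *\<^sub>C s t) = c * simple_vintegral m s"
proof -
  have J: "finite (range s)" "range s \<subseteq> range s"
    using s by (auto simp: simple_function_def)
  have "s -` {x} \<in> sets borel" for x
    using simple_functionD(2)[OF s, of "{x}"] by simp
  then have "m (s -` {x}) (c *\<^sub>C x) = c * m (s -` {x}) x" if "x \<in> range s" for x
    using m that by (auto simp: rcabv_def complex_dual_def)
  then show ?thesis
    using simple_vintegral_compose[OF m s J, of "\<lambda>x. c *\<^sub>C x"]
    by (simp add: simple_vintegral_def sum_distrib_left)
qed

lemma scaleC_minus_one: "(- 1) *\<^sub>C x = - x"
  using scaleC_of_real[of "-1" x] by simp

lemma simple_vintegral_diff: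
  assumes m: "m \<in> rcabv" and s: "simple_function borel s" "simple_function borel u"
  shows "simple_vintegral m (\<lambda>t. s t - u t) = simple_vintegral m s - simple_vintegral m u"
proof -
  have "simple_function borel (\<lambda>t. (- 1) *\<^sub>C u t)"
    using s(2) by (rule simple_function_compose1)
  from simple_vintegral_add[OF m s(1) this] simple_vintegral_scaleC[OF m s(2), of "-1"]
  show ?thesis
    by (simp add: scaleC_minus_one)
qed

text \<open>Two different bounds on \<open>A\<close> and on its complement are kept because the norm formula below compares
  a continuous function with a simple one from which it differs only on a set of small variation.\<close>

lemma norm_simple_vintegral_le:
  assumes m: "m \<in> rcabv" and s: "simple_function borel s" and A: "A \<in> sets borel"
    and c: "\<And>t. t \<in> A \<Longrightarrow> norm (s t) \<le> c" and d: "\<And>t. t \<notin> A \<Longrightarrow> norm (s t) \<le> d"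
    and "0 \<le> c" "0 \<le> d"
  shows "cmod (simple_vintegral m s) \<le> c * real_variation m A + d * real_variation m (- A)"
proof -
  define p where "p = (\<lambda>t. (s t, t \<in> A))"
  have sA: "simple_function borel (\<lambda>t. t \<in> A)"
    using simple_function_compose1[OF simple_function_indicator[OF A], of "\<lambda>x::real. x = 1"]
    by (simp add: indicator_def)
  have p: "simple_function borel p"
    unfolding p_def using s sA by (rule simple_function_Pair)
  have fin: "finite (range s)" using s by (simp add: simple_function_def)
  have pb: "p -` {j} \<in> sets borel" for j
    using simple_functionD(2)[OF p, of "{j}"] by simp
  have "simple_vintegral m s = simple_vintegral m (\<lambda>t. fst (p t))"
    by (simp add: p_def)
  also have "\<dots> = (\<Sum>j\<in>range s \<times> UNIV. m (p -` {j}) (fst j))"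
    using fin by (intro simple_vintegral_compose[OF m p]) (auto simp: p_def)
  also have "\<dots> = (\<Sum>x\<in>range s. m (p -` {(x, True)}) x + m (p -` {(x, False)}) x)"
    by (simp add: sum.cartesian_product' UNIV_bool add.commute)
  also have "cmod \<dots> \<le> (\<Sum>x\<in>range s. cmod (m (p -` {(x, True)}) x) + cmod (m (p -` {(x, False)}) x))"
    by (intro sum_norm_le norm_triangle_ineq)
  also have "\<dots> \<le> (\<Sum>x\<in>range s. c * norm (m (p -` {(x, True)})) + d * norm (m (p -` {(x, False)})))"
  proof (intro sum_mono add_mono)
    have bound: "cmod (m (p -` {(x, b)}) x) \<le> e * norm (m (p -` {(x, b)}))"
      if "\<And>t. p t = (x, b) \<Longrightarrow> norm x \<le> e" "0 \<le> e" for x b e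
    proof (cases "p -` {(x, b)} = {}")
      case True
      then show ?thesis by (simp add: rcabv_empty[OF m])
    next
      case False
      then have "norm x \<le> e" using that(1) by auto
      then show ?thesis
        using norm_blinfun[of "m (p -` {(x, b)})" x]
        by (smt (verit) mult.commute mult_right_mono norm_ge_zero)
    qed
    fix x
    show "cmod (m (p -` {(x, True)}) x) \<le> c * norm (m (p -` {(x, True)}))"
      using c \<open>0 \<le> c\<close> by (intro bound) (auto simp: p_def)
    show "cmod (m (p -` {(x, False)}) x) \<le> d * norm (m (p -` {(x, False)}))"
      using d \<open>0 \<le> d\<close> by (intro bound) (auto simp: p_def)
  qed
  also have "\<dots> = c * (\<Sum>x\<in>range s. norm (m (p -` {(x, True)})))
      + d * (\<Sum>x\<in>range s. norm (m (p -` {(x, False)})))"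
    by (simp add: sum.distrib sum_distrib_left)
  also have "\<dots> \<le> c * real_variation m A + d * real_variation m (- A)"
    using \<open>0 \<le> c\<close> \<open>0 \<le> d\<close> A fin pb
    by (intro add_mono mult_left_mono sum_norm_le_real_variation[OF m])
      (auto simp: disjoint_family_on_def p_def)
  finally show ?thesis .
qed

lemma le_add_mult_epsilon:
  fixes a b v :: real
  assumes le: "\<And>e. e > 0 \<Longrightarrow> a \<le> b + e * v" and "0 \<le> v"
  shows "a \<le> b"
proof (rule field_le_epsilon)
  fix e :: real assume "0 < e"
  have "a \<le> b + e / (v + 1) * v"
    using \<open>0 < e\<close> \<open>0 \<le> v\<close> by (intro le) simp
  also have "e / (v + 1) * v \<le> e"
    using \<open>0 < e\<close> \<open>0 \<le> v\<close> by (simp add: field_simps)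
  finally show "a \<le> b + e" by simp
qed

text \<open>The estimate for simple functions passes to uniform limits. Uniqueness of the integral, its
  boundedness, and the error estimate in the norm formula all follow from it.\<close>

lemma has_vintegral_diff_le:
  assumes m: "m \<in> rcabv" and f: "has_vintegral m f I"
    and u: "simple_function borel u" and A: "A \<in> sets borel"
    and c: "\<And>t. t \<in> A \<Longrightarrow> norm (f t - u t) \<le> c" and d: "\<And>t. t \<notin> A \<Longrightarrow> norm (f t - u t) \<le> d"
    and "0 \<le> c" "0 \<le> d"
  shows "cmod (I - simple_vintegral m u) \<le> c * real_variation m A + d * real_variation m (- A)"
proof -
  obtain s where s: "\<And>n. simple_function borel (s n)" and lim: "uniform_limit UNIV s f sequentially"
    and I: "(\<lambda>n. simple_vintegral m (s n)) \<longlonglongrightarrow> I"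
    using f unfolding has_vintegral_def by blast
  define v where "v = real_variation m A + real_variation m (- A)"
  have v: "0 \<le> v" by (simp add: v_def)
  let ?b = "c * real_variation m A + d * real_variation m (- A)"
  have "cmod (I - simple_vintegral m u) \<le> ?b + e * v" if "e > 0" for e
  proof (rule tendsto_upperbound)
    show "(\<lambda>n. cmod (simple_vintegral m (s n) - simple_vintegral m u))
        \<longlonglongrightarrow> cmod (I - simple_vintegral m u)"
      by (intro tendsto_intros I)
    have "\<forall>\<^sub>F n in sequentially. \<forall>t\<in>UNIV. dist (s n t) (f t) < e"
      using lim that by (rule uniform_limitD)
    then show "\<forall>\<^sub>F n in sequentially. cmod (simple_vintegral m (s n) - simple_vintegral m u) \<le> ?b + e * v"
    proof eventually_elim
      case (elim n)
      have near: "norm (s n t - u t) \<le> b + e" if "norm (f t - u t) \<le> b" for t b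
        using that elim[rule_format, of t] norm_triangle_ineq[of "s n t - f t" "f t - u t"]
        by (simp add: dist_norm)
      have "cmod (simple_vintegral m (\<lambda>t. s n t - u t))
          \<le> (c + e) * real_variation m A + (d + e) * real_variation m (- A)"
        using s u A c d near \<open>0 \<le> c\<close> \<open>0 \<le> d\<close> \<open>e > 0\<close>
        by (intro norm_simple_vintegral_le[OF m]) (auto intro: simple_function_diff)
      then show ?case
        by (simp add: simple_vintegral_diff[OF m s u] v_def algebra_simps)
    qed
  qed simp
  then show ?thesis
    using v by (rule le_add_mult_epsilon)
qed

lemma has_vintegral_diff_le_UNIV:
  assumes m: "m \<in> rcabv" and f: "has_vintegral m f I"
    and u: "simple_function borel u"
    and c: "\<And>t. norm (f t - u t) \<le> c"
  shows "cmod (I - simple_vintegral m u) \<le> c * norm_rcabv m"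
proof -
  have "0 \<le> c" using c[of undefined] norm_ge_zero order_trans by blast
  have "real_variation m {} \<le> (\<Sum>i\<in>{}. real_variation m {})"
    using real_variation_UN_le[OF m, of "{}" "\<lambda>_. {}"] by (simp add: disjoint_family_on_def)
  then have "real_variation m {} = 0" by (simp add: order_antisym)
  with has_vintegral_diff_le[OF m f u, of UNIV c 0] c \<open>0 \<le> c\<close>
  show ?thesis by (simp add: norm_rcabv_def real_variation_def)
qed

lemma has_vintegral_unique:
  assumes m: "m \<in> rcabv" and f: "has_vintegral m f I" "has_vintegral m f J"
  shows "I = J"
proof -
  obtain s where s: "\<And>n. simple_function borel (s n)" and lim: "uniform_limit UNIV s f sequentially"
    and J: "(\<lambda>n. simple_vintegral m (s n)) \<longlonglongrightarrow> J"
    using f(2) unfolding has_vintegral_def by blast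
  have v: "0 \<le> norm_rcabv m" by (simp add: norm_rcabv_def)
  have "cmod (I - J) \<le> 0 + e * norm_rcabv m" if "e > 0" for e
  proof (rule tendsto_upperbound)
    show "(\<lambda>n. cmod (I - simple_vintegral m (s n))) \<longlonglongrightarrow> cmod (I - J)"
      by (intro tendsto_intros J)
    have "\<forall>\<^sub>F n in sequentially. \<forall>t\<in>UNIV. dist (s n t) (f t) < e"
      using lim that by (rule uniform_limitD)
    then show "\<forall>\<^sub>F n in sequentially. cmod (I - simple_vintegral m (s n)) \<le> 0 + e * norm_rcabv m"
    proof eventually_elim
      case (elim n)
      have "norm (f t - s n t) \<le> e" for t
        using elim by (simp add: dist_norm norm_minus_commute less_imp_le)
      then have "cmod (I - simple_vintegral m (s n)) \<le> e * norm_rcabv m"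
        by (rule has_vintegral_diff_le_UNIV[OF m f(1) s])
      then show ?case by simp
    qed
  qed simp
  then have "cmod (I - J) \<le> 0"
    using v by (rule le_add_mult_epsilon)
  then show ?thesis by simp
qed

lemma vintegral_eqI:
  assumes "m \<in> rcabv" and "has_vintegral m f I"
  shows "vintegral m f = I"
  unfolding vintegral_def using assms has_vintegral_unique by blast

text \<open>The range of \<open>f\<close> is compact, so finitely many \<open>e\<close>-balls cover it; the centre of one of the balls that
  contain \<open>f t\<close> can be taken as the value at \<open>t\<close>.\<close>

lemma simple_approximation:
  fixes f :: "'k::t2_space \<Rightarrow> 'x::real_normed_vector"
  assumes K: "compact (UNIV :: 'k set)" and f: "continuous_on UNIV f" and "e > 0"
  obtains s where "simple_function borel s" and "\<And>t. norm (s t - f t) < e"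
proof -
  have "compact (range f)"
    using f K by (rule compact_continuous_image)
  moreover have "f t \<in> (\<Union>x\<in>range f. ball x e)" for t
    using \<open>e > 0\<close> by (intro UN_I[of "f t"]) simp_all
  then have "range f \<subseteq> (\<Union>x\<in>range f. ball x e)"
    by (rule image_subsetI)
  ultimately obtain D where "D \<subseteq> range f" and D: "finite D" "range f \<subseteq> (\<Union>x\<in>D. ball x e)"
    using compactE_image[of "range f" "range f" "\<lambda>x. ball x e"] open_ball by metis
  have "\<exists>s. simple_function borel s \<and> (\<forall>t. f t \<in> (\<Union>x\<in>D. ball x e) \<longrightarrow> norm (s t - f t) < e)"
    using D(1)
  proof (induction D)
    case empty
    show ?case by (rule exI[of _ "\<lambda>_. 0"]) simp
  next
    case (insert x D)
    from insert.IH obtain s where s: "simple_function borel s"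
      "\<And>t. f t \<in> (\<Union>x\<in>D. ball x e) \<Longrightarrow> norm (s t - f t) < e" by auto
    have "f -` ball x e \<in> sets borel"
      using f by (intro borel_open) (simp add: continuous_on_open_vimage)
    moreover have "{t \<in> space borel. f t \<in> ball x e} = f -` ball x e"
      by auto
    ultimately have "simple_function borel (\<lambda>t. if f t \<in> ball x e then x else s t)"
      using s(1) by (intro simple_function_If) simp_all
    moreover have "norm ((if f t \<in> ball x e then x else s t) - f t) < e"
      if "f t \<in> (\<Union>x\<in>insert x D. ball x e)" for t
      using s(2)[of t] that by (auto simp: dist_norm)
    ultimately show ?case
      by (intro exI[of _ "\<lambda>t. if f t \<in> ball x e then x else s t"] conjI allI impI)
  qed
  then obtain s where s: "simple_function borel s"
    and near: "\<And>t. f t \<in> (\<Union>x\<in>D. ball x e) \<Longrightarrow> norm (s t - f t) < e" by auto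
  show ?thesis
    using s near[OF subsetD[OF D(2) rangeI]] by (rule that)
qed

lemma has_vintegral_vintegral:
  fixes f :: "'k::t2_space \<Rightarrow> 'x::complex_normed_vector"
  assumes K: "compact (UNIV :: 'k set)" and f: "continuous_on UNIV f" and m: "m \<in> rcabv"
  shows "has_vintegral m f (vintegral m f)"
proof -
  have "\<exists>s. simple_function borel s \<and> (\<forall>t. norm (s t - f t) < inverse (real (Suc n)))" for n
    using simple_approximation[OF K f, of "inverse (real (Suc n))"] by (metis inverse_positive_iff_positive of_nat_0_less_iff zero_less_Suc)
  then obtain s where s: "\<And>n. simple_function borel (s n)"
    and near: "\<And>n t. norm (s n t - f t) < inverse (real (Suc n))" by metis
  have lim: "uniform_limit UNIV s f sequentially"
    unfolding uniform_limit_iff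
  proof safe
    fix e :: real assume "e > 0"
    then have "\<forall>\<^sub>F n in sequentially. inverse (real (Suc n)) < e"
      using LIMSEQ_inverse_real_of_nat by (rule order_tendstoD(2)[rotated])
    then show "\<forall>\<^sub>F n in sequentially. \<forall>t\<in>UNIV. dist (s n t) (f t) < e"
      by eventually_elim (auto simp: dist_norm intro: less_trans near)
  qed
  have v: "0 \<le> norm_rcabv m" by (simp add: norm_rcabv_def)
  have "Cauchy (\<lambda>n. simple_vintegral m (s n))"
  proof (rule metric_CauchyI)
    fix e :: real assume "e > 0"
    define e' where "e' = e / (2 * (norm_rcabv m + 1))"
    have "e' > 0" using \<open>e > 0\<close> v by (simp add: e'_def)
    obtain N where N: "inverse (real (Suc N)) < e'"
      using reals_Archimedean[OF \<open>e' > 0\<close>] by blast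
    have less: "norm (s n t - f t) < e'" if "n \<ge> N" for n t
    proof -
      have "inverse (real (Suc n)) \<le> inverse (real (Suc N))"
        using that by (simp add: le_imp_inverse_le)
      with near[of n t] N show ?thesis by linarith
    qed
    show "\<exists>M. \<forall>i\<ge>M. \<forall>j\<ge>M. dist (simple_vintegral m (s i)) (simple_vintegral m (s j)) < e"
    proof (intro exI allI impI)
      fix i j assume ij: "i \<ge> N" "j \<ge> N"
      have "norm (s i t - s j t) \<le> 2 * e'" for t
        using less[OF ij(1), of t] less[OF ij(2), of t] norm_triangle_ineq4[of "s i t - f t" "s j t - f t"]
        by simp
      then have "cmod (simple_vintegral m (\<lambda>t. s i t - s j t))
          \<le> 2 * e' * real_variation m UNIV + 0 * real_variation m (- UNIV)"
        using \<open>e' > 0\<close> s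
        by (intro norm_simple_vintegral_le[OF m]) (auto intro: simple_function_diff)
      also have "\<dots> = 2 * e' * norm_rcabv m"
        by (simp add: real_variation_def norm_rcabv_def)
      also have "\<dots> < 2 * e' * (norm_rcabv m + 1)"
        using \<open>e' > 0\<close> by simp
      also have "\<dots> = e"
        using v by (simp add: e'_def field_simps)
      finally show "dist (simple_vintegral m (s i)) (simple_vintegral m (s j)) < e"
        by (simp add: simple_vintegral_diff[OF m s s] dist_norm)
    qed
  qed
  then obtain I where "(\<lambda>n. simple_vintegral m (s n)) \<longlonglongrightarrow> I"
    using Cauchy_convergent_iff convergent_def by blast
  then have "has_vintegral m f I"
    using s lim unfolding has_vintegral_def by blast
  then show ?thesis using vintegral_eqI[OF m] by metis
qed

lemma has_vintegral_add:
  assumes m: "m \<in> rcabv" and "has_vintegral m f I" "has_vintegral m g J"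
  shows "has_vintegral m (\<lambda>t. f t + g t) (I + J)"
proof -
  obtain s where s: "\<And>n. simple_function borel (s n)" and lims: "uniform_limit UNIV s f sequentially"
    and I: "(\<lambda>n. simple_vintegral m (s n)) \<longlonglongrightarrow> I"
    using assms(2) unfolding has_vintegral_def by blast
  obtain u where u: "\<And>n. simple_function borel (u n)" and limu: "uniform_limit UNIV u g sequentially"
    and J: "(\<lambda>n. simple_vintegral m (u n)) \<longlonglongrightarrow> J"
    using assms(3) unfolding has_vintegral_def by blast
  show ?thesis
    unfolding has_vintegral_def
  proof (intro exI conjI allI)
    show "simple_function borel (\<lambda>t. s n t + u n t)" for n
      using s u by (rule simple_function_add)
    show "uniform_limit UNIV (\<lambda>n t. s n t + u n t) (\<lambda>t. f t + g t) sequentially"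
      using lims limu by (rule uniform_limit_add)
    show "(\<lambda>n. simple_vintegral m (\<lambda>t. s n t + u n t)) \<longlonglongrightarrow> I + J"
      unfolding simple_vintegral_add[OF m s u] by (intro tendsto_intros I J)
  qed
qed

lemma has_vintegral_scaleC:
  assumes m: "m \<in> rcabv" and "has_vintegral m f I"
  shows "has_vintegral m (\<lambda>t. c *\<^sub>C f t) (c * I)"
proof -
  obtain s where s: "\<And>n. simple_function borel (s n)" and lims: "uniform_limit UNIV s f sequentially"
    and I: "(\<lambda>n. simple_vintegral m (s n)) \<longlonglongrightarrow> I"
    using assms(2) unfolding has_vintegral_def by blast
  show ?thesis
    unfolding has_vintegral_def
  proof (intro exI conjI allI)
    show "simple_function borel (\<lambda>t. c *\<^sub>C s n t)" for n
      using s by (rule simple_function_compose1)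
    show "uniform_limit UNIV (\<lambda>n t. c *\<^sub>C s n t) (\<lambda>t. c *\<^sub>C f t) sequentially"
      unfolding uniform_limit_iff
    proof safe
      fix e :: real assume "e > 0"
      have diff: "c *\<^sub>C (x - y) = c *\<^sub>C x - c *\<^sub>C y" for x y :: 'b
        using scaleC_add_right[of c "x - y" y] by (simp add: algebra_simps)
      have pos: "0 < e / (cmod c + 1)" using \<open>e > 0\<close> by (simp add: add_nonneg_pos)
      have "\<forall>\<^sub>F n in sequentially. \<forall>t\<in>UNIV. dist (s n t) (f t) < e / (cmod c + 1)"
        using lims pos by (rule uniform_limitD)
      then show "\<forall>\<^sub>F n in sequentially. \<forall>t\<in>UNIV. dist (c *\<^sub>C s n t) (c *\<^sub>C f t) < e"
      proof eventually_elim
        case (elim n)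
        show ?case
        proof
          fix t
          have "norm (c *\<^sub>C s n t - c *\<^sub>C f t) = cmod c * norm (s n t - f t)"
            by (simp add: norm_scaleC flip: diff)
          also have "\<dots> \<le> cmod c * (e / (cmod c + 1))"
            using elim by (intro mult_left_mono) (auto simp: dist_norm less_imp_le)
          also have "\<dots> < (cmod c + 1) * (e / (cmod c + 1))"
            by (rule mult_strict_right_mono[OF _ pos]) simp
          also have "\<dots> = e"
            using pos \<open>e > 0\<close> by (simp add: zero_less_divide_iff)
          finally show "dist (c *\<^sub>C s n t) (c *\<^sub>C f t) < e" by (simp add: dist_norm)
        qed
      qed
    qed
    show "(\<lambda>n. simple_vintegral m (\<lambda>t. c *\<^sub>C s n t)) \<longlonglongrightarrow> c * I"
      unfolding simple_vintegral_scaleC[OF m s] by (intro tendsto_intros I)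
  qed
qed

section \<open>The norm of an integral functional\<close>

lemma apply_bcontfun_Bcontfun_compact:
  fixes f :: "'k::t2_space \<Rightarrow> 'x::real_normed_vector"
  assumes K: "compact (UNIV :: 'k set)" and f: "continuous_on UNIV f"
  shows "apply_bcontfun (Bcontfun f) = f"
proof -
  have "bounded (range f)"
    using compact_continuous_image[OF f K] by (rule compact_imp_bounded)
  then have "f \<in> bcontfun"
    using f by (simp add: bcontfun_def)
  then show ?thesis by (rule Bcontfun_inverse)
qed

lemma urysohn_compact:
  fixes S T :: "'k::t2_space set"
  assumes K: "compact (UNIV :: 'k set)" and S: "closed S" and T: "closed T" and "S \<inter> T = {}"
  obtains h :: "'k \<Rightarrow> real" where "continuous_on UNIV h"
    and "\<And>t. t \<in> S \<Longrightarrow> h t = 0" and "\<And>t. t \<in> T \<Longrightarrow> h t = 1"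
proof -
  have "normal_space (euclidean :: 'k topology)"
    using K by (intro compact_Hausdorff_or_regular_imp_normal_space)
      (auto simp: compact_space_def Hausdorff_space_def disjnt_def separation_t2)
  then obtain h where h: "continuous_map (euclidean :: 'k topology) (top_of_set {0..1::real}) h"
    and "h ` S \<subseteq> {0}" and "h ` T \<subseteq> {1}"
    using Urysohn_lemma[of "euclidean :: 'k topology" S T 0 1] S T \<open>S \<inter> T = {}\<close>
    by (auto simp: disjnt_def)
  moreover have "continuous_on UNIV h"
    using h by (simp add: continuous_map_in_subtopology)
  moreover have "h t = 0" if "t \<in> S" for t
    using \<open>h ` S \<subseteq> {0}\<close> that by blast
  moreover have "h t = 1" if "t \<in> T" for t
    using \<open>h ` T \<subseteq> {1}\<close> that by blast
  ultimately show ?thesis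
    by (intro that)
qed

text \<open>The sum of the \<open>x i\<close> with Urysohn functions as coefficients takes the right values on the sets \<open>C i\<close>;
  retracting it radially to the unit ball keeps these values and makes the norm at most one.\<close>

lemma bcontfun_interpolation:
  fixes C :: "'i \<Rightarrow> 'k::t2_space set" and x :: "'i \<Rightarrow> 'x::real_normed_vector"
  assumes K: "compact (UNIV :: 'k set)" and I: "finite I"
    and C: "\<And>i. i \<in> I \<Longrightarrow> closed (C i)" and disj: "disjoint_family_on C I"
    and x: "\<And>i. i \<in> I \<Longrightarrow> norm (x i) \<le> 1"
  shows "\<exists>\<omega> :: 'k \<Rightarrow>\<^sub>C 'x. norm \<omega> \<le> 1 \<and> (\<forall>i\<in>I. \<forall>t\<in>C i. apply_bcontfun \<omega> t = x i)"
proof -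
  have "\<exists>h :: 'k \<Rightarrow> real. continuous_on UNIV h \<and> (\<forall>t \<in> \<Union>(C ` (I - {i})). h t = 0) \<and> (\<forall>t\<in>C i. h t = 1)"
    if "i \<in> I" for i
  proof -
    have cl: "closed (\<Union>(C ` (I - {i})))"
      using I C by (intro closed_UN) auto
    have "\<Union>(C ` (I - {i})) \<inter> C i = {}"
      using disj that by (auto simp: disjoint_family_on_def)
    with C[OF that] show ?thesis
      by (rule urysohn_compact[OF K cl]) blast
  qed
  then obtain h :: "'i \<Rightarrow> 'k \<Rightarrow> real" where h: "\<And>i. i \<in> I \<Longrightarrow> continuous_on UNIV (h i)"
    and h0: "\<And>i t. i \<in> I \<Longrightarrow> t \<in> \<Union>(C ` (I - {i})) \<Longrightarrow> h i t = 0"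
    and h1: "\<And>i t. i \<in> I \<Longrightarrow> t \<in> C i \<Longrightarrow> h i t = 1"
    by metis
  define g where "g t = (\<Sum>i\<in>I. h i t *\<^sub>R x i)" for t
  define \<omega> where "\<omega> t = (1 / max 1 (norm (g t))) *\<^sub>R g t" for t
  have g: "continuous_on UNIV g"
    unfolding g_def by (intro continuous_intros h)
  have cont: "continuous_on UNIV \<omega>"
    unfolding \<omega>_def by (intro continuous_intros g) (auto simp: max_def)
  have g_eq: "g t = x i" if "i \<in> I" "t \<in> C i" for i t
  proof -
    have "g t = (\<Sum>j\<in>I. if j = i then x i else 0)"
      unfolding g_def
    proof (rule sum.cong)
      fix j assume "j \<in> I"
      then show "h j t *\<^sub>R x j = (if j = i then x i else 0)"
        using that h0[of j t] h1[of i t] by auto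
    qed simp
    then show ?thesis using I that by simp
  qed
  show ?thesis
  proof (intro exI[of _ "Bcontfun \<omega>"] conjI ballI)
    show "norm (Bcontfun \<omega>) \<le> 1"
    proof (rule norm_bound)
      fix t
      have "norm (\<omega> t) \<le> 1"
        by (simp add: \<omega>_def divide_le_eq)
      then show "norm (apply_bcontfun (Bcontfun \<omega>) t) \<le> 1"
        by (simp add: apply_bcontfun_Bcontfun_compact[OF K cont])
    qed
    fix i t assume "i \<in> I" "t \<in> C i"
    then show "apply_bcontfun (Bcontfun \<omega>) t = x i"
      using x[of i] g_eq[of i t] by (simp add: apply_bcontfun_Bcontfun_compact[OF K cont] \<omega>_def)
  qed
qed

lemma complex_dual_almost_norming:
  fixes f :: "'x::complex_normed_vector \<Rightarrow>\<^sub>L complex"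
  assumes f: "f \<in> complex_dual" and "e > 0"
  obtains x where "norm x \<le> 1" and "norm f - e \<le> Re (f x)"
proof (cases "norm f \<le> e")
  case True
  then show ?thesis by (intro that[of 0]) auto
next
  case False
  have "\<exists>x. cmod (f x) > (norm f - e) * norm x"
  proof (rule ccontr)
    assume "\<not> ?thesis"
    then have "norm f \<le> norm f - e"
      using False by (intro norm_blinfun_bound) (auto simp: not_less)
    with \<open>e > 0\<close> show False by simp
  qed
  then obtain x where x: "cmod (f x) > (norm f - e) * norm x" by blast
  then have "x \<noteq> 0" by auto
  have "f x \<noteq> 0"
    using x False by (auto simp: mult_less_0_iff)
  \<comment> \<open>Normalised, and rotated so that \<open>f y\<close> is real and positive.\<close>
  define y where "y = (cnj (sgn (f x)) / norm x) *\<^sub>C x"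
  show ?thesis
  proof (rule that[of y])
    show "norm y \<le> 1"
      using \<open>x \<noteq> 0\<close> \<open>f x \<noteq> 0\<close> by (simp add: y_def norm_scaleC norm_divide norm_sgn)
    have "cnj (sgn (f x)) * f x = cmod (f x)"
      using \<open>f x \<noteq> 0\<close> complex_norm_square[of "f x"]
      by (simp add: sgn_div_norm scaleR_conv_of_real field_simps power2_eq_square)
    then have "f y = complex_of_real (cmod (f x) / norm x)"
      using f by (simp add: y_def complex_dual_def)
    moreover have "norm f - e < cmod (f x) / norm x"
      using x \<open>x \<noteq> 0\<close> by (simp add: less_divide_eq)
    ultimately show "norm f - e \<le> Re (f y)"
      by simp
  qed
qed

definition vintegral_functional ::
    "('k::t2_space set \<Rightarrow> 'x::complex_normed_vector \<Rightarrow>\<^sub>L complex) \<Rightarrow> ('k \<Rightarrow>\<^sub>C 'x) \<Rightarrow>\<^sub>L complex"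
  where "vintegral_functional m = Blinfun (\<lambda>\<omega>. vintegral m (apply_bcontfun \<omega>))"

context
  fixes m :: "'k::t2_space set \<Rightarrow> 'x::complex_normed_vector \<Rightarrow>\<^sub>L complex"
  assumes K: "compact (UNIV :: 'k set)" and m: "m \<in> rcabv"
begin

lemma has_vintegral_bcontfun: "has_vintegral m (apply_bcontfun \<omega>) (vintegral m (apply_bcontfun \<omega>))"
  by (rule has_vintegral_vintegral[OF K _ m]) simp

lemma vintegral_scaleC:
  "vintegral m (apply_bcontfun (c *\<^sub>C \<omega>)) = c * vintegral m (apply_bcontfun \<omega>)"
  using has_vintegral_scaleC[OF m has_vintegral_bcontfun, of c \<omega>]
  by (intro vintegral_eqI[OF m]) (simp add: apply_bcontfun_scaleC[abs_def])

lemma vintegral_add: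
  "vintegral m (apply_bcontfun (\<omega> + \<theta>)) = vintegral m (apply_bcontfun \<omega>) + vintegral m (apply_bcontfun \<theta>)"
  using has_vintegral_add[OF m has_vintegral_bcontfun has_vintegral_bcontfun, of \<omega> \<theta>]
  by (intro vintegral_eqI[OF m]) (simp add: plus_bcontfun.rep_eq)

lemma norm_vintegral_le: "cmod (vintegral m (apply_bcontfun \<omega>)) \<le> norm \<omega> * norm_rcabv m"
proof -
  have "simple_vintegral m (\<lambda>_. 0) = 0"
    by (simp add: simple_vintegral_def)
  with has_vintegral_diff_le_UNIV[OF m has_vintegral_bcontfun, of "\<lambda>_. 0" \<omega> "norm \<omega>"]
  show ?thesis by (simp add: norm_bounded)
qed

lemma vintegral_functional_apply:
  "vintegral_functional m \<omega> = vintegral m (apply_bcontfun \<omega>)"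
proof -
  have "bounded_linear (\<lambda>\<omega>. vintegral m (apply_bcontfun \<omega>))"
  proof (rule bounded_linear_intro)
    show "vintegral m (apply_bcontfun (r *\<^sub>R \<omega>)) = r *\<^sub>R vintegral m (apply_bcontfun \<omega>)" for r \<omega>
      using vintegral_scaleC[of "of_real r" \<omega>] unfolding scaleC_of_real scaleR_conv_of_real .
  qed (rule vintegral_add norm_vintegral_le)+
  then show ?thesis
    unfolding vintegral_functional_def by (simp add: bounded_linear_Blinfun_apply)
qed

lemma vintegral_functional_complex_dual: "vintegral_functional m \<in> complex_dual"
  by (simp add: complex_dual_def vintegral_functional_apply vintegral_scaleC)

text \<open>For the inequality from below, take a partition \<open>P\<close> that almost realises the variation and, for each
  piece \<open>B\<close>, a vector \<open>x B\<close> in the unit ball almost norming \<open>m B\<close>. The simple function with value \<open>x B\<close> on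
  \<open>B\<close> then has an integral close to the variation. By regularity each \<open>B\<close> contains a compact set \<open>C B\<close> up
  to small variation, and a continuous function of norm at most one that equals \<open>x B\<close> on each \<open>C B\<close>
  has nearly the same integral.\<close>

theorem norm_vintegral_functional: "norm (vintegral_functional m) = norm_rcabv m"
proof (rule antisym)
  show "norm (vintegral_functional m) \<le> norm_rcabv m"
  proof (rule norm_blinfun_bound)
    show "0 \<le> norm_rcabv m" by (simp add: norm_rcabv_def)
    show "cmod (vintegral_functional m \<omega>) \<le> norm_rcabv m * norm \<omega>" for \<omega>
      using norm_vintegral_le[of \<omega>] by (simp add: vintegral_functional_apply mult.commute)
  qed
  show "norm_rcabv m \<le> norm (vintegral_functional m)"
  proof (rule field_le_epsilon)
    fix e :: real assume "e > 0"
    \<comment> \<open>One share of \<open>e\<close> is lost in the choice of the partition, one in the choice of the vectors, and two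
      in the comparison of integrals, where the two functions may differ by 2.\<close>
    define e0 where "e0 = e / 4"
    have "e0 > 0" using \<open>e > 0\<close> by (simp add: e0_def)
    obtain P where P: "finite P" "disjoint P" "P \<subseteq> sets borel" "\<Union>P = UNIV"
      and sumP: "norm_rcabv m - e0 \<le> (\<Sum>B\<in>P. norm (m B))"
    proof (rule ccontr)
      assume "\<not> thesis"
      with that have *: "(\<Sum>B\<in>P. norm (m B)) \<le> norm_rcabv m - e0"
        if "finite P" "disjoint P" "P \<subseteq> sets borel" "\<Union>P = UNIV" for P
        using that by (meson linear)
      have "0 \<le> norm_rcabv m - e0"
        by (rule order_trans[OF sum_nonneg *[of "{UNIV}"]]) (auto simp: disjoint_def)
      have "variation m UNIV \<le> ennreal (norm_rcabv m - e0)"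
        unfolding variation_def by (rule SUP_least) (use * in \<open>auto simp: ennreal_leI\<close>)
      then have "ennreal (norm_rcabv m) \<le> ennreal (norm_rcabv m - e0)"
        using ennreal_real_variation[OF m, of UNIV] by (simp add: norm_rcabv_def real_variation_def)
      with \<open>0 \<le> norm_rcabv m - e0\<close> \<open>e0 > 0\<close> show False by simp
    qed
    have Pb: "B \<in> sets borel" if "B \<in> P" for B using P(3) that by blast
    \<comment> \<open>An error of \<open>e1\<close> on each piece adds up to at most \<open>e0\<close>.\<close>
    define e1 where "e1 = e0 / (real (card P) + 1)"
    have "e1 > 0" using \<open>e0 > 0\<close> by (simp add: e1_def)
    have "real (card P) * e1 \<le> (real (card P) + 1) * e1"
      using \<open>e1 > 0\<close> by simp
    also have "\<dots> = e0" by (simp add: e1_def)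
    finally have card_e1: "real (card P) * e1 \<le> e0" .

    have "\<exists>x. norm x \<le> 1 \<and> norm (m B) - e1 \<le> Re (m B x)" if "B \<in> P" for B
    proof -
      have "m B \<in> complex_dual" using m Pb[OF that] by (simp add: rcabv_def)
      then show ?thesis by (rule complex_dual_almost_norming[OF _ \<open>e1 > 0\<close>]) blast
    qed
    then obtain x where x: "\<And>B. B \<in> P \<Longrightarrow> norm (x B) \<le> 1"
      and mx: "\<And>B. B \<in> P \<Longrightarrow> norm (m B) - e1 \<le> Re (m B (x B))" by metis

    have "\<exists>C. compact C \<and> C \<subseteq> B \<and> real_variation m (B - C) \<le> e1" if "B \<in> P" for B
    proof -
      have "\<forall>A \<in> sets borel. \<forall>e > 0. \<exists>C U. compact C \<and> open U \<and> C \<subseteq> A \<and> A \<subseteq> U \<and>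
          variation m (U - C) < ennreal e"
        using m unfolding rcabv_def mem_Collect_eq by (elim conjE)
      from this[rule_format, OF Pb[OF that] \<open>e1 > 0\<close>]
      obtain C U where CU: "compact C" "open U" "C \<subseteq> B" "B \<subseteq> U" "variation m (U - C) < ennreal e1"
        by blast
      have "variation m (B - C) \<le> variation m (U - C)"
        using CU compact_imp_closed[OF CU(1)]
        by (intro variation_mono rcabv_empty[OF m]) auto
      with CU(5) have "ennreal (real_variation m (B - C)) \<le> ennreal e1"
        unfolding ennreal_real_variation[OF m] by simp
      with CU \<open>e1 > 0\<close> show ?thesis by auto
    qed
    then obtain C where C: "\<And>B. B \<in> P \<Longrightarrow> compact (C B)" "\<And>B. B \<in> P \<Longrightarrow> C B \<subseteq> B"
      and varC: "\<And>B. B \<in> P \<Longrightarrow> real_variation m (B - C B) \<le> e1" by metis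
    have disjP: "A \<inter> B = {}" if "A \<in> P" "B \<in> P" "A \<noteq> B" for A B
      using P(2) that by (auto simp: disjoint_def)
    have disjC: "disjoint_family_on C P"
      using disjP C(2) unfolding disjoint_family_on_def by blast
    have "\<exists>\<omega> :: 'k \<Rightarrow>\<^sub>C 'x. norm \<omega> \<le> 1 \<and> (\<forall>B\<in>P. \<forall>t\<in>C B. apply_bcontfun \<omega> t = x B)"
      by (intro bcontfun_interpolation K P(1) compact_imp_closed C(1) disjC x)
    then obtain \<omega> :: "'k \<Rightarrow>\<^sub>C 'x" where \<omega>: "norm \<omega> \<le> 1"
      and \<omega>C: "\<And>B t. B \<in> P \<Longrightarrow> t \<in> C B \<Longrightarrow> apply_bcontfun \<omega> t = x B"
      by auto

    define p where "p t = (THE B. B \<in> P \<and> t \<in> B)" for t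
    have p_eq: "p t = B" if "B \<in> P" "t \<in> B" for t B
      unfolding p_def
    proof (rule the_equality)
      show "A = B" if "A \<in> P \<and> t \<in> A" for A
        using that disjP[of A B] \<open>B \<in> P\<close> \<open>t \<in> B\<close> by auto
    qed (use that in simp)
    have pP: "p t \<in> P" "t \<in> p t" for t
    proof -
      have "t \<in> \<Union>P" by (simp add: P(4))
      then obtain B where B: "t \<in> B" "B \<in> P" by (rule UnionE)
      then show "p t \<in> P" "t \<in> p t" by (simp_all add: p_eq[OF B(2,1)])
    qed
    have vimage_p: "p -` {B} = B" if "B \<in> P" for B
    proof (intro subset_antisym subsetI)
      show "t \<in> B" if "t \<in> p -` {B}" for t using that pP(2)[of t] by simp
      show "t \<in> p -` {B}" if "t \<in> B" for t using p_eq[OF \<open>B \<in> P\<close> that] by simp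
    qed
    have p: "simple_function borel p"
      unfolding simple_function_def
    proof safe
      show "finite (p ` space borel)"
        by (rule finite_subset[OF image_subsetI[OF pP(1)] P(1)])
      show "p -` {p t} \<inter> space borel \<in> sets borel" for t
        using vimage_p[OF pP(1)] Pb[OF pP(1)] by simp
    qed
    have s: "simple_function borel (\<lambda>t. x (p t))"
      using p by (rule simple_function_compose1)
    have int_s: "simple_vintegral m (\<lambda>t. x (p t)) = (\<Sum>B\<in>P. m B (x B))"
    proof -
      have "range p \<subseteq> P" using pP(1) by (rule image_subsetI)
      from simple_vintegral_compose[OF m p P(1) this, of x] show ?thesis
        by (simp add: vimage_p)
    qed

    define D where "D = (\<Union>B\<in>P. B - C B)"
    have DB: "B - C B \<in> sets borel" if "B \<in> P" for B
      using Pb[OF that] compact_imp_closed[OF C(1)[OF that]] by auto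
    have "disjoint_family_on (\<lambda>B. B - C B) P"
      using disjP unfolding disjoint_family_on_def by blast
    then have "real_variation m D \<le> (\<Sum>B\<in>P. real_variation m (B - C B))"
      unfolding D_def using P(1) DB by (intro real_variation_UN_le[OF m])
    also have "\<dots> \<le> (\<Sum>B\<in>P. e1)"
      by (rule sum_mono) (rule varC)
    also have "\<dots> \<le> e0" using card_e1 by simp
    finally have varD: "real_variation m D \<le> e0" .
    have "cmod (vintegral m (apply_bcontfun \<omega>) - simple_vintegral m (\<lambda>t. x (p t)))
        \<le> 2 * real_variation m D + 0 * real_variation m (- D)"
    proof (rule has_vintegral_diff_le[OF m has_vintegral_bcontfun s])
      show "D \<in> sets borel" unfolding D_def using P(1) DB by (rule sets.finite_UN)
      show "norm (apply_bcontfun \<omega> t - x (p t)) \<le> 2" for t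
        using norm_triangle_ineq4[of "apply_bcontfun \<omega> t" "x (p t)"] x[OF pP(1)[of t]]
          norm_bounded[of \<omega> t] \<omega> by linarith
      show "norm (apply_bcontfun \<omega> t - x (p t)) \<le> 0" if "t \<notin> D" for t
        using that pP[of t] \<omega>C[of "p t" t] by (auto simp: D_def)
    qed auto
    then have close: "cmod (vintegral m (apply_bcontfun \<omega>) - (\<Sum>B\<in>P. m B (x B))) \<le> 2 * e0"
      using varD by (simp add: int_s)

    have "norm_rcabv m - e0 \<le> (\<Sum>B\<in>P. norm (m B))" by (rule sumP)
    also have "\<dots> \<le> (\<Sum>B\<in>P. Re (m B (x B)) + e1)"
      by (rule sum_mono) (use mx in \<open>simp add: algebra_simps\<close>)
    also have "\<dots> \<le> Re (\<Sum>B\<in>P. m B (x B)) + e0"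
      using card_e1 by (simp add: sum.distrib)
    also have "Re (\<Sum>B\<in>P. m B (x B)) \<le> Re (vintegral m (apply_bcontfun \<omega>)) + 2 * e0"
      using close abs_Re_le_cmod[of "vintegral m (apply_bcontfun \<omega>) - (\<Sum>B\<in>P. m B (x B))"] by simp
    also have "Re (vintegral m (apply_bcontfun \<omega>)) \<le> norm (vintegral_functional m) * norm \<omega>"
      using complex_Re_le_cmod norm_blinfun[of "vintegral_functional m" \<omega>]
      unfolding vintegral_functional_apply by (rule order_trans)
    also have "\<dots> \<le> norm (vintegral_functional m) * 1"
      using \<omega> by (intro mult_left_mono) auto
    finally show "norm_rcabv m \<le> norm (vintegral_functional m) + e"
      by (simp add: e0_def)
  qed
qed

end

section \<open>The Hahn-Banach theorem\<close>

definition sublinear :: "('a::real_vector \<Rightarrow> real) \<Rightarrow> bool" where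
  "sublinear p \<longleftrightarrow> (\<forall>x y. p (x + y) \<le> p x + p y) \<and> (\<forall>r x. 0 \<le> r \<longrightarrow> p (r *\<^sub>R x) = r * p x)"

lemma sublinear_add: "sublinear p \<Longrightarrow> p (x + y) \<le> p x + p y"
  and sublinear_scaleR: "sublinear p \<Longrightarrow> 0 \<le> r \<Longrightarrow> p (r *\<^sub>R x) = r * p x"
  by (simp_all add: sublinear_def)

lemma sublinear_zero: "sublinear p \<Longrightarrow> p 0 = 0"
  using sublinear_scaleR[of p 0 0] by simp

lemma sublinear_minus: "sublinear p \<Longrightarrow> - p (- x) \<le> p x"
  using sublinear_add[of p x "- x"] by (simp add: sublinear_zero)

text \<open>The conditions say that the family is directed enough for subadditivity and homogeneity to survive in
  the infimum. The lemma serves three times: for chains in Zorn's lemma, for showing that minimal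
  sublinear functionals are linear, and for encoding the values to be prescribed in the extension
  theorem.\<close>

lemma sublinear_INF:
  fixes F :: "'i \<Rightarrow> 'a::real_vector \<Rightarrow> real"
  assumes "I \<noteq> {}" and bdd: "\<And>i x. i \<in> I \<Longrightarrow> b x \<le> F i x"
    and add: "\<And>i j x y. i \<in> I \<Longrightarrow> j \<in> I \<Longrightarrow> \<exists>k\<in>I. F k (x + y) \<le> F i x + F j y"
    and scale: "\<And>i r x. i \<in> I \<Longrightarrow> 0 < r \<Longrightarrow> \<exists>k\<in>I. F k (r *\<^sub>R x) \<le> r * F i x"
  shows "sublinear (\<lambda>x. INF i\<in>I. F i x)"
proof -
  define u where "u x = (INF i\<in>I. F i x)" for x
  have le: "u x \<le> F i x" if "i \<in> I" for i x
    unfolding u_def using bdd that by (intro cINF_lower bdd_belowI2[where m = "b x"])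
  have greatest: "a \<le> u x" if "\<And>i. i \<in> I \<Longrightarrow> a \<le> F i x" for a x
    unfolding u_def using \<open>I \<noteq> {}\<close> that by (rule cINF_greatest)
  have "u (x + y) \<le> u x + u y" for x y
  proof -
    have *: "u (x + y) \<le> F i x + F j y" if "i \<in> I" "j \<in> I" for i j
      using add[OF that, of x y] le by (meson order_trans)
    have "u (x + y) - F i x \<le> u y" if "i \<in> I" for i
      using *[OF that] by (intro greatest) (simp add: algebra_simps)
    then have "u (x + y) - u y \<le> u x"
      by (intro greatest) (simp add: algebra_simps)
    then show ?thesis by simp
  qed
  moreover have scale_le: "u (r *\<^sub>R x) \<le> r * u x" if "0 < r" for r x
  proof -
    have "u (r *\<^sub>R x) \<le> r * F i x" if "i \<in> I" for i
      using scale[OF that \<open>0 < r\<close>, of x] le by (meson order_trans)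
    then have "u (r *\<^sub>R x) / r \<le> u x"
      using \<open>0 < r\<close> by (intro greatest) (simp add: field_simps)
    then show ?thesis using \<open>0 < r\<close> by (simp add: field_simps)
  qed
  have "u (r *\<^sub>R x) = r * u x" if "0 \<le> r" for r x
  proof (cases "r = 0")
    case True
    then show ?thesis
      using scale_le[of 2 0] scale_le[of "1/2" 0] by simp
  next
    case False
    then have "0 < r" using that by simp
    then have "u x \<le> (1 / r) * u (r *\<^sub>R x)"
      using scale_le[of "1 / r" "r *\<^sub>R x"] by simp
    with scale_le[OF \<open>0 < r\<close>, of x] \<open>0 < r\<close> show ?thesis
      by (simp add: field_simps)
  qed
  ultimately show ?thesis
    unfolding sublinear_def u_def by blast
qed

text \<open>A chain of sublinear functionals below \<open>p\<close> is bounded from below at \<open>x\<close> by \<open>- p (- x)\<close>, so its pointwise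
  infimum exists and is a lower bound for Zorn's lemma.\<close>

lemma minimal_sublinear:
  fixes p :: "'a::real_vector \<Rightarrow> real"
  assumes p: "sublinear p"
  obtains q where "sublinear q" and "q \<le> p" and "\<And>q'. sublinear q' \<Longrightarrow> q' \<le> q \<Longrightarrow> q' = q"
proof -
  define A where "A = {q. sublinear q \<and> q \<le> p}"
  define P where "P = (\<lambda>q q'. q' \<le> (q :: 'a \<Rightarrow> real))"
  have po: "partial_order_on A (relation_of P A)"
    by (rule partial_order_on_relation_ofI) (auto simp: P_def)
  have "\<exists>m\<in>A. \<forall>a\<in>A. P m a \<longrightarrow> a = m"
  proof (rule predicate_Zorn[OF po])
    fix C assume C: "C \<in> Chains (relation_of P A)"
    then have CA: "q \<in> A" if "q \<in> C" for q
      using that by (auto simp: Chains_def relation_of_def)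
    have total: "q \<le> q' \<or> q' \<le> q" if "q \<in> C" "q' \<in> C" for q q'
      using C that by (auto simp: Chains_def relation_of_def P_def)
    show "\<exists>u\<in>A. \<forall>q\<in>C. P q u"
    proof (cases "C = {}")
      case True
      then show ?thesis using p by (intro bexI[of _ p]) (auto simp: A_def)
    next
      case False
      have bdd: "- p (- x) \<le> q x" if "q \<in> C" for q x
        using sublinear_minus[of q x] CA[OF that] le_funD[of q p "- x"] by (simp add: A_def)
      have "sublinear (\<lambda>x. INF q\<in>C. q x)"
      proof (rule sublinear_INF[OF False bdd])
        fix q q' x y assume q: "q \<in> C" "q' \<in> C"
        have *: "sublinear q" "sublinear q'" using CA q by (auto simp: A_def)
        show "\<exists>k\<in>C. k (x + y) \<le> q x + q' y"
        proof (cases "q \<le> q'")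
          case True
          then show ?thesis
            using sublinear_add[OF *(1), of x y] le_funD[of q q' y] q by (intro bexI[of _ q]) auto
        next
          case False
          then have "q' \<le> q" using total q by blast
          then show ?thesis
            using sublinear_add[OF *(2), of x y] le_funD[of q' q x] q by (intro bexI[of _ q']) auto
        qed
      next
        fix q and r :: real and x assume "q \<in> C" "0 < r"
        then show "\<exists>k\<in>C. k (r *\<^sub>R x) \<le> r * q x"
          using CA[of q] by (intro bexI[of _ q]) (auto simp: A_def sublinear_scaleR)
      qed
      moreover have lower: "(\<lambda>x. INF q\<in>C. q x) \<le> q" if "q \<in> C" for q
        using bdd that by (intro le_funI cINF_lower bdd_belowI2[where m = "- p (- _)"])
      moreover obtain q where "q \<in> C" using False by blast
      then have "(\<lambda>x. INF q\<in>C. q x) \<le> p"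
        using lower[of q] CA[of q] by (auto simp: A_def intro: order_trans)
      ultimately show ?thesis
        by (intro bexI[of _ "\<lambda>x. INF q\<in>C. q x"]) (auto simp: A_def P_def)
    qed
  qed
  then obtain q where "q \<in> A" and "\<And>q'. q' \<in> A \<Longrightarrow> q' \<le> q \<Longrightarrow> q' = q"
    by (auto simp: P_def)
  then show ?thesis
    by (intro that[of q]) (auto simp: A_def intro: order_trans)
qed

text \<open>A minimal sublinear \<open>q\<close> is linear: for fixed \<open>y\<close>, the infimum over \<open>t \<ge> 0\<close> of \<open>q (x + t y) - t q y\<close> is
  sublinear and at most \<open>q\<close>, hence equal to \<open>q\<close>, and \<open>t = 1\<close> gives superadditivity.\<close>

lemma linear_minorant:
  fixes p :: "'a::real_vector \<Rightarrow> real"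
  assumes "sublinear p"
  obtains g where "linear g" and "\<And>x. g x \<le> p x"
proof -
  obtain q where q: "sublinear q" and "q \<le> p"
    and min: "\<And>q'. sublinear q' \<Longrightarrow> q' \<le> q \<Longrightarrow> q' = q"
    using minimal_sublinear[OF assms] by metis
  have superadd: "q x + q y \<le> q (x + y)" for x y
  proof -
    define F where "F t z = q (z + t *\<^sub>R y) - t * q y" for t z
    have bdd: "- q (- z) \<le> F t z" if "t \<in> {0..}" for t z
      using sublinear_add[OF q, of "z + t *\<^sub>R y" "- z"] sublinear_scaleR[OF q, of t y] that
      by (simp add: F_def)
    have "sublinear (\<lambda>z. INF t\<in>{0..}. F t z)"
    proof (rule sublinear_INF[OF _ bdd])
      fix s t v w assume "s \<in> {0::real..}" "t \<in> {0::real..}"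
      then show "\<exists>k\<in>{0..}. F k (v + w) \<le> F s v + F t w"
        using sublinear_add[OF q, of "v + s *\<^sub>R y" "w + t *\<^sub>R y"]
        by (intro bexI[of _ "s + t"]) (auto simp: F_def algebra_simps)
    next
      fix t r :: real and z assume "t \<in> {0..}" "0 < r"
      then show "\<exists>k\<in>{0..}. F k (r *\<^sub>R z) \<le> r * F t z"
        using sublinear_scaleR[OF q, of r "z + t *\<^sub>R y"]
        by (intro bexI[of _ "r * t"]) (auto simp: F_def algebra_simps)
    qed auto
    moreover have lower: "(INF t\<in>{0..}. F t z) \<le> F t z" if "t \<in> {0..}" for t z
      using bdd that by (intro cINF_lower bdd_belowI2[where m = "- q (- z)"])
    then have "(\<lambda>z. INF t\<in>{0..}. F t z) \<le> q"
      using lower[of 0] by (intro le_funI) (simp add: F_def)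
    ultimately have "(\<lambda>z. INF t\<in>{0..}. F t z) = q"
      by (rule min)
    then have "q x \<le> F 1 x"
      using lower[of 1 x] fun_cong by fastforce
    then show ?thesis by (simp add: F_def)
  qed
  have add: "q (x + y) = q x + q y" for x y
    using superadd sublinear_add[OF q] by (rule antisym[rotated])
  have minus: "q (- x) = - q x" for x
    using add[of x "- x"] sublinear_zero[OF q] by simp
  have "linear q"
  proof (rule linearI)
    show "q (r *\<^sub>R x) = r *\<^sub>R q x" for r x
    proof (cases "0 \<le> r")
      case True
      then show ?thesis by (simp add: sublinear_scaleR[OF q])
    next
      case False
      then show ?thesis
        using sublinear_scaleR[OF q, of "- r" x] minus[of "r *\<^sub>R x"] by simp
    qed
  qed (rule add)
  with \<open>q \<le> p\<close> show ?thesis by (intro that[of q]) (auto dest: le_funD)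
qed

text \<open>The subspace on which values are prescribed is given as the range of a linear map \<open>M\<close>, the prescribed
  value at \<open>M e\<close> being \<open>l e\<close>; consistency of these values follows from the bound. A linear minorant of
  \<open>x \<mapsto> INF e. R * norm (x - M e) + l e\<close> is at most \<open>R * norm x\<close> (take \<open>e = 0\<close>) and at most \<open>l e\<close> at
  \<open>x = M e\<close>; replacing \<open>e\<close> by \<open>- e\<close> turns the latter into an equality.\<close>

theorem hahn_banach_through_linear_map:
  fixes M :: "'e::real_vector \<Rightarrow> 'x::real_normed_vector" and l :: "'e \<Rightarrow> real"
  assumes M: "linear M" and l: "linear l" and le: "\<And>e. l e \<le> R * norm (M e)" and "0 \<le> R"
  obtains g :: "'x \<Rightarrow>\<^sub>L real" where "norm g \<le> R" and "\<And>e. g (M e) = l e"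
proof -
  define F where "F e x = R * norm (x - M e) + l e" for e x
  have bdd: "- (R * norm x) \<le> F e x" for e x
  proof -
    have "- l e \<le> R * norm (M e)"
      using le[of "- e"] by (simp add: linear_neg[OF M] linear_neg[OF l])
    also have "\<dots> \<le> R * (norm (x - M e) + norm x)"
      using \<open>0 \<le> R\<close> norm_triangle_sub[of "M e" x] by (intro mult_left_mono) (auto simp: norm_minus_commute)
    finally show ?thesis by (simp add: F_def algebra_simps)
  qed
  have "sublinear (\<lambda>x. INF e\<in>UNIV. F e x)"
  proof (rule sublinear_INF[OF _ bdd])
    fix d e x y
    have "R * norm (x + y - M (d + e)) \<le> R * (norm (x - M d) + norm (y - M e))"
      using \<open>0 \<le> R\<close> norm_triangle_ineq[of "x - M d" "y - M e"]
      by (intro mult_left_mono) (simp_all add: linear_add[OF M] algebra_simps)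
    then show "\<exists>k\<in>UNIV. F k (x + y) \<le> F d x + F e y"
      by (intro bexI[of _ "d + e"]) (auto simp: F_def linear_add[OF l] algebra_simps)
  next
    fix e x and r :: real assume "0 < r"
    have "r *\<^sub>R x - M (r *\<^sub>R e) = r *\<^sub>R (x - M e)"
      by (simp add: linear_scale[OF M] algebra_simps)
    with \<open>0 < r\<close> have "norm (r *\<^sub>R x - M (r *\<^sub>R e)) = r * norm (x - M e)"
      by simp
    then show "\<exists>k\<in>UNIV. F k (r *\<^sub>R x) \<le> r * F e x"
      using \<open>0 < r\<close> by (intro bexI[of _ "r *\<^sub>R e"]) (auto simp: F_def linear_scale[OF l] algebra_simps)
  qed auto
  then obtain g where g: "linear g" and "\<And>x. g x \<le> (INF e\<in>UNIV. F e x)"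
    using linear_minorant by blast
  moreover have "(INF e\<in>UNIV. F e x) \<le> F e x" for e x
    using bdd by (intro cINF_lower bdd_belowI2[where m = "- (R * norm x)"]) simp_all
  ultimately have gF: "g x \<le> F e x" for x e
    by (meson order_trans)
  have g_le: "g x \<le> R * norm x" for x
    using gF[of x 0] by (simp add: F_def linear_0[OF M] linear_0[OF l])
  have g_abs: "\<bar>g x\<bar> \<le> R * norm x" for x
    using g_le[of x] g_le[of "- x"] by (simp add: linear_neg[OF g])
  have "bounded_linear g"
    using g_abs by (intro bounded_linear_intro[where K = R])
      (auto simp: linear_add[OF g] linear_scale[OF g] mult.commute)
  then have app: "blinfun_apply (Blinfun g) = g"
    by (rule bounded_linear_Blinfun_apply)
  have gM: "g (M e) \<le> l e" for e
    using gF[of "M e" e] by (simp add: F_def)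
  show ?thesis
  proof (rule that[of "Blinfun g"])
    show "norm (Blinfun g) \<le> R"
      using g_abs \<open>0 \<le> R\<close> by (intro norm_blinfun_bound) (simp_all add: app)
    show "Blinfun g (M e) = l e" for e
      using gM[of e] gM[of "- e"]
      by (simp add: app linear_neg[OF M] linear_neg[OF l] linear_neg[OF g])
  qed
qed

corollary norming_functional:
  fixes v :: "'x::real_normed_vector"
  obtains g :: "'x \<Rightarrow>\<^sub>L real" where "norm g \<le> 1" and "g v = norm v"
proof -
  have "linear (\<lambda>r. r *\<^sub>R v)" "linear (\<lambda>r. r * norm v)"
    by (auto intro!: linearI simp: algebra_simps)
  moreover have "r * norm v \<le> 1 * norm (r *\<^sub>R v)" for r
    by (simp add: mult_right_mono)
  ultimately obtain g :: "'x \<Rightarrow>\<^sub>L real" where "norm g \<le> 1" "\<And>r. g (r *\<^sub>R v) = r * norm v"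
    using hahn_banach_through_linear_map[of "\<lambda>r. r *\<^sub>R v" "\<lambda>r. r * norm v" 1] by auto
  from this(1) this(2)[of 1] that show ?thesis by simp
qed

section \<open>Functionals on finite-dimensional spaces of continuous functions\<close>

lemma linear_eq_inner:
  fixes l :: "'e::euclidean_space \<Rightarrow> real"
  assumes "linear l"
  obtains w where "\<And>e. l e = e \<bullet> w"
  using adjoint_works[OF assms, of _ 1] by (intro that[of "adjoint l 1"]) simp

text \<open>The space \<open>'e\<close> parametrises finitely many functions through \<open>L\<close>, and functionals on it are identified
  with vectors by the inner product. The set \<open>S\<close> of the vectors \<open>w\<close> with
  \<open>e \<bullet> w \<le> R * norm (L e t)\<close> for some \<open>t\<close> and all \<open>e\<close> is compact, and by the Hahn-Banach theorem it
  consists of the functionals \<open>e \<mapsto> x' (L e t)\<close> with \<open>norm x' \<le> R\<close>. If the vector \<open>w0\<close> of \<open>l\<close> were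
  outside the convex hull of \<open>S\<close>, a separating direction \<open>a\<close> would contradict the bound on \<open>l\<close>: at a
  point where \<open>L (- a)\<close> attains its norm, a norming functional yields an element of \<open>S\<close> on the wrong
  side.\<close>

theorem finite_combination_of_point_functionals:
  fixes L :: "'e::euclidean_space \<Rightarrow> 'k::t2_space \<Rightarrow>\<^sub>C 'x::real_normed_vector" and l :: "'e \<Rightarrow> real"
  assumes K: "compact (UNIV :: 'k set)" and L: "linear L" and l: "linear l"
    and le: "\<And>e. l e \<le> R * norm (L e)" and "0 \<le> R"
  obtains T and \<xi> :: "'k \<Rightarrow> 'x \<Rightarrow>\<^sub>L real" where "finite T" and "(\<Sum>t\<in>T. norm (\<xi> t)) \<le> R"
    and "\<And>e. (\<Sum>t\<in>T. \<xi> t (apply_bcontfun (L e) t)) = l e"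
proof -
  define S where "S = {w. \<exists>t. \<forall>e. e \<bullet> w \<le> R * norm (apply_bcontfun (L e) t)}"
  obtain w0 where w0: "\<And>e. l e = e \<bullet> w0"
    using linear_eq_inner[OF l] by blast
  obtain B where B: "\<And>e. norm (L e) \<le> B * norm e"
    using linear_bounded[OF L] by blast
  have "compact S"
  proof -
    define Z where "Z = {q :: 'k \<times> 'e. \<forall>e. e \<bullet> snd q \<le> R * norm (apply_bcontfun (L e) (fst q))}"
    have cont: "continuous_on UNIV (\<lambda>q :: 'k \<times> 'e. apply_bcontfun (L e) (fst q))" for e
      by (rule continuous_on_compose2[of UNIV "apply_bcontfun (L e)"]) (auto intro!: continuous_intros)
    have "closed Z"
      unfolding Z_def
      by (intro closed_Collect_all closed_Collect_le continuous_intros cont)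
    have "norm w \<le> R * B" if w: "\<forall>e. e \<bullet> w \<le> R * norm (apply_bcontfun (L e) t)" for w t
    proof (cases "w = 0")
      case True
      have "0 \<le> B"
        using B[of "SOME b. b \<in> Basis"] norm_ge_zero[of "L (SOME b. b \<in> Basis)"] SOME_Basis
        by (simp del: norm_ge_zero)
      with True \<open>0 \<le> R\<close> show ?thesis by simp
    next
      case False
      have "norm w * norm w \<le> R * norm (apply_bcontfun (L w) t)"
        using w[rule_format, of w] by (simp add: dot_square_norm power2_eq_square)
      also have "\<dots> \<le> R * (B * norm w)"
        using \<open>0 \<le> R\<close> B[of w] norm_bounded[of "L w" t] by (intro mult_left_mono) auto
      finally show ?thesis using False by (simp add: mult.assoc[symmetric])
    qed
    then have "S = snd ` ((UNIV \<times> cball 0 (R * B)) \<inter> Z)"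
      by (force simp: S_def Z_def image_iff)
    moreover have "compact ((UNIV \<times> cball 0 (R * B)) \<inter> Z)"
      using K \<open>closed Z\<close> by (intro compact_Int_closed compact_Times) auto
    then have "compact (snd ` ((UNIV \<times> cball 0 (R * B)) \<inter> Z))"
      by (intro compact_continuous_image continuous_intros)
    ultimately show ?thesis by simp
  qed
  have "w0 \<in> convex hull S"
  proof (rule ccontr)
    assume "w0 \<notin> convex hull S"
    moreover have "closed (convex hull S)"
      using compact_convex_hull[OF \<open>compact S\<close>] by (rule compact_imp_closed)
    ultimately obtain a b where a: "a \<bullet> w0 < b" "\<And>w. w \<in> convex hull S \<Longrightarrow> b < a \<bullet> w"
      using separating_hyperplane_closed_point[OF convex_convex_hull] by metis
    define \<omega> where "\<omega> = L (- a)"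
    obtain t where t: "\<And>s. norm (apply_bcontfun \<omega> s) \<le> norm (apply_bcontfun \<omega> t)"
      using continuous_attains_sup[OF K, of "\<lambda>s. norm (apply_bcontfun \<omega> s)"]
      by (auto intro: continuous_intros)
    have norm_\<omega>: "norm \<omega> \<le> norm (apply_bcontfun \<omega> t)"
      using t by (rule norm_bound)
    obtain g :: "'x \<Rightarrow>\<^sub>L real" where g: "norm g \<le> 1" "g (apply_bcontfun \<omega> t) = norm (apply_bcontfun \<omega> t)"
      using norming_functional by blast
    have "linear (\<lambda>e. R * g (apply_bcontfun (L e) t))"
      by (rule linearI)
        (simp_all add: linear_add[OF L] linear_scale[OF L] blinfun.add_right blinfun.scaleR_right algebra_simps)
    then obtain w where w: "\<And>e. R * g (apply_bcontfun (L e) t) = e \<bullet> w"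
      using linear_eq_inner by blast
    have "e \<bullet> w \<le> R * norm (apply_bcontfun (L e) t)" for e
    proof -
      have "g (apply_bcontfun (L e) t) \<le> norm g * norm (apply_bcontfun (L e) t)"
        using norm_blinfun[of g "apply_bcontfun (L e) t"] by simp
      also have "\<dots> \<le> 1 * norm (apply_bcontfun (L e) t)"
        using g(1) by (rule mult_right_mono) simp
      finally have "R * g (apply_bcontfun (L e) t) \<le> R * norm (apply_bcontfun (L e) t)"
        using \<open>0 \<le> R\<close> by (simp add: mult_left_mono)
      then show ?thesis by (simp add: w)
    qed
    then have "w \<in> S" unfolding S_def by blast
    then have "b < a \<bullet> w" by (intro a(2) hull_inc)
    moreover have "(- a) \<bullet> w = R * norm (apply_bcontfun \<omega> t)"
      using w[of "- a"] g(2) by (simp add: \<omega>_def)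
    moreover have "(- a) \<bullet> w0 \<le> R * norm (apply_bcontfun \<omega> t)"
      using le[of "- a"] w0[of "- a"] norm_\<omega> \<open>0 \<le> R\<close> mult_left_mono[OF norm_\<omega> \<open>0 \<le> R\<close>]
      by (simp add: \<omega>_def)
    ultimately show False using a(1) by simp
  qed
  then obtain W u where W: "finite W" "W \<subseteq> S" and u: "\<And>w. w \<in> W \<Longrightarrow> 0 \<le> u w" "sum u W = 1"
    and w0_eq: "(\<Sum>w\<in>W. u w *\<^sub>R w) = w0"
    unfolding convex_hull_explicit by auto
  have "\<exists>t g. norm g \<le> R \<and> (\<forall>e. blinfun_apply g (apply_bcontfun (L e) t) = e \<bullet> w)" if w: "w \<in> W" for w
  proof -
    obtain t where t: "\<And>e. e \<bullet> w \<le> R * norm (apply_bcontfun (L e) t)"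
      using W(2) w unfolding S_def by blast
    have Lt: "linear (\<lambda>e. apply_bcontfun (L e) t)"
      by (rule linearI) (simp_all add: linear_add[OF L] linear_scale[OF L])
    have "linear (\<lambda>e. e \<bullet> w)"
      by (rule linearI) (simp_all add: inner_add_left)
    then obtain g :: "'x \<Rightarrow>\<^sub>L real" where "norm g \<le> R" "\<And>e. g (apply_bcontfun (L e) t) = e \<bullet> w"
      using hahn_banach_through_linear_map[OF Lt _ t \<open>0 \<le> R\<close>] by blast
    then show ?thesis by blast
  qed
  then obtain \<tau> :: "'e \<Rightarrow> 'k" and g :: "'e \<Rightarrow> 'x \<Rightarrow>\<^sub>L real" where g_norm: "\<And>w. w \<in> W \<Longrightarrow> norm (g w) \<le> R"
    and g_eq: "\<And>w e. w \<in> W \<Longrightarrow> g w (apply_bcontfun (L e) (\<tau> w)) = e \<bullet> w"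
    by metis
  \<comment> \<open>Different \<open>w\<close> may belong to the same point, so their functionals are collected there.\<close>
  define \<xi> where "\<xi> t = (\<Sum>w\<in>{w\<in>W. \<tau> w = t}. u w *\<^sub>R g w)" for t
  show ?thesis
  proof (rule that[of "\<tau> ` W" \<xi>])
    show "finite (\<tau> ` W)" using W by simp
    have "(\<Sum>t\<in>\<tau> ` W. norm (\<xi> t)) \<le> (\<Sum>t\<in>\<tau> ` W. \<Sum>w\<in>{w\<in>W. \<tau> w = t}. u w * R)"
      unfolding \<xi>_def
    proof (intro sum_mono sum_norm_le)
      fix t w assume "w \<in> {w\<in>W. \<tau> w = t}"
      then show "norm (u w *\<^sub>R g w) \<le> u w * R"
        using u(1)[of w] g_norm[of w] by (simp add: mult_left_mono)
    qed
    also have "\<dots> = (\<Sum>w\<in>W. u w * R)"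
      using W(1) by (intro sum.group) auto
    also have "\<dots> = R" by (simp add: u(2) flip: sum_distrib_right)
    finally show "(\<Sum>t\<in>\<tau> ` W. norm (\<xi> t)) \<le> R" .
    fix e
    have "(\<Sum>t\<in>\<tau> ` W. \<xi> t (apply_bcontfun (L e) t))
        = (\<Sum>t\<in>\<tau> ` W. \<Sum>w\<in>{w\<in>W. \<tau> w = t}. u w * (e \<bullet> w))"
      unfolding \<xi>_def blinfun.sum_left
      by (intro sum.cong) (auto simp: blinfun.scaleR_left g_eq)
    also have "\<dots> = (\<Sum>w\<in>W. u w * (e \<bullet> w))"
      using W(1) by (intro sum.group) auto
    also have "\<dots> = e \<bullet> w0"
      by (simp add: inner_sum_right flip: w0_eq)
    finally show "(\<Sum>t\<in>\<tau> ` W. \<xi> t (apply_bcontfun (L e) t)) = l e"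
      by (simp add: w0)
  qed
qed

section \<open>Measures with finitely many atoms\<close>

definition atomic_measure ::
    "'k set \<Rightarrow> ('k \<Rightarrow> 'e::real_normed_vector) \<Rightarrow> 'k set \<Rightarrow> 'e" where
  "atomic_measure T \<xi> A = (\<Sum>t\<in>T \<inter> A. \<xi> t)"

text \<open>Partitioning into the singletons of the atoms shows that no cancellation between atoms
  lowers the variation.\<close>

lemma variation_atomic_measure:
  fixes T :: "'k::t2_space set"
  assumes T: "finite T" and A: "A \<in> sets borel"
  shows "variation (atomic_measure T \<xi>) A = ennreal (\<Sum>t\<in>T \<inter> A. norm (\<xi> t))"
proof (rule antisym)
  show "variation (atomic_measure T \<xi>) A \<le> ennreal (\<Sum>t\<in>T \<inter> A. norm (\<xi> t))"
    unfolding variation_def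
  proof (rule SUP_least)
    fix P assume "P \<in> {P. finite P \<and> disjoint P \<and> P \<subseteq> sets borel \<and> \<Union>P = A}"
    then have P: "finite P" "disjoint P" "\<Union>P = A" by auto
    have "(\<Sum>B\<in>P. norm (atomic_measure T \<xi> B)) \<le> (\<Sum>B\<in>P. \<Sum>t\<in>T \<inter> B. norm (\<xi> t))"
      unfolding atomic_measure_def by (intro sum_mono norm_sum)
    also have "\<dots> = (\<Sum>t\<in>(\<Union>B\<in>P. T \<inter> B). norm (\<xi> t))"
      using P T by (intro sum.UNION_disjoint[symmetric]) (auto simp: disjoint_def)
    also have "(\<Union>B\<in>P. T \<inter> B) = T \<inter> A"
      using P(3) by auto
    finally show "(\<Sum>B\<in>P. ennreal (norm (atomic_measure T \<xi> B))) \<le> ennreal (\<Sum>t\<in>T \<inter> A. norm (\<xi> t))"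
      by (simp add: ennreal_leI)
  qed
  have "ennreal (\<Sum>t\<in>T \<inter> A. norm (\<xi> t)) = (\<Sum>t\<in>T \<inter> A. ennreal (norm (atomic_measure T \<xi> {t})))"
    by (simp add: atomic_measure_def)
  also have "\<dots> \<le> variation (atomic_measure T \<xi>) A"
    using T A by (intro sum_norm_le_variation) (auto simp: atomic_measure_def disjoint_family_on_def)
  finally show "ennreal (\<Sum>t\<in>T \<inter> A. norm (\<xi> t)) \<le> variation (atomic_measure T \<xi>) A" .
qed

lemma norm_rcabv_atomic_measure:
  fixes T :: "'k::t2_space set"
  assumes "finite T"
  shows "norm_rcabv (atomic_measure T \<xi>) = (\<Sum>t\<in>T. norm (\<xi> t))"
  using assms by (simp add: norm_rcabv_def variation_atomic_measure sum_nonneg)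

lemma atomic_measure_sums:
  assumes T: "finite T" and A: "disjoint_family (A :: nat \<Rightarrow> _)"
  shows "(\<lambda>i. atomic_measure T \<xi> (A i)) sums atomic_measure T \<xi> (\<Union>i. A i)"
proof -
  have eq: "atomic_measure T \<xi> B = (\<Sum>t\<in>T. if t \<in> B then \<xi> t else 0)" for B
    unfolding atomic_measure_def using T by (rule sum.inter_restrict)
  have "(\<lambda>i. if t \<in> A i then \<xi> t else 0) sums (if t \<in> (\<Union>i. A i) then \<xi> t else 0)" for t
  proof (cases "t \<in> (\<Union>i. A i)")
    case True
    then obtain j where "t \<in> A j" by blast
    then have "t \<in> A i \<longleftrightarrow> i = j" for i
      using A by (auto simp: disjoint_family_on_def)
    then show ?thesis
      using True sums_single[of j "\<lambda>_. \<xi> t"] by simp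
  qed auto
  then show ?thesis
    unfolding eq by (rule sums_sum)
qed

lemma complex_dual_sum:
  "(\<And>t. t \<in> T \<Longrightarrow> \<xi> t \<in> complex_dual) \<Longrightarrow> (\<Sum>t\<in>T. \<xi> t) \<in> complex_dual"
  by (simp add: complex_dual_def blinfun.sum_left sum_distrib_left)

lemma atomic_measure_rcabv:
  fixes T :: "'k::t2_space set" and \<xi> :: "'k \<Rightarrow> 'x::complex_normed_vector \<Rightarrow>\<^sub>L complex"
  assumes T: "finite T" and \<xi>: "\<And>t. t \<in> T \<Longrightarrow> \<xi> t \<in> complex_dual"
  shows "atomic_measure T \<xi> \<in> rcabv"
proof -
  have "\<exists>C U. compact C \<and> open U \<and> C \<subseteq> A \<and> A \<subseteq> U \<and> variation (atomic_measure T \<xi>) (U - C) < ennreal e"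
    if "A \<in> sets borel" "e > 0" for A e
  proof (intro exI conjI)
    \<comment> \<open>The open set omits the finitely many atoms outside \<open>A\<close>, so no atom is left in the difference.\<close>
    show "compact (T \<inter> A)" using T by (intro finite_imp_compact) simp
    show "open (- (T - A))" using T by (intro open_Compl finite_imp_closed) simp
    have "T \<inter> (- (T - A) - T \<inter> A) = {}" by auto
    moreover have "- (T - A) - T \<inter> A \<in> sets borel"
      using T by (intro sets.Diff borel_open borel_closed open_Compl finite_imp_closed) auto
    ultimately show "variation (atomic_measure T \<xi>) (- (T - A) - T \<inter> A) < ennreal e"
      using \<open>e > 0\<close> by (simp add: variation_atomic_measure[OF T])
  qed auto
  moreover have "atomic_measure T \<xi> A \<in> complex_dual" for A
    unfolding atomic_measure_def using \<xi> by (intro complex_dual_sum) auto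
  moreover have "variation (atomic_measure T \<xi>) UNIV < \<infinity>"
    by (simp add: variation_atomic_measure[OF T])
  ultimately show ?thesis
    unfolding rcabv_def mem_Collect_eq
    by (intro conjI ballI allI impI) (blast intro: atomic_measure_sums[OF T])+
qed

lemma simple_vintegral_atomic_measure:
  assumes T: "finite T" and s: "simple_function borel s"
  shows "simple_vintegral (atomic_measure T \<xi>) s = (\<Sum>t\<in>T. \<xi> t (s t))"
proof -
  have "simple_vintegral (atomic_measure T \<xi>) s = (\<Sum>x\<in>range s. \<Sum>t\<in>{t\<in>T. s t = x}. \<xi> t (s t))"
    unfolding simple_vintegral_def atomic_measure_def blinfun.sum_left
    by (intro sum.cong) auto
  also have "\<dots> = (\<Sum>t\<in>T. \<xi> t (s t))"
    using T s by (intro sum.group) (auto simp: simple_function_def)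
  finally show ?thesis .
qed

lemma vintegral_atomic_measure:
  fixes T :: "'k::t2_space set" and \<xi> :: "'k \<Rightarrow> 'x::complex_normed_vector \<Rightarrow>\<^sub>L complex"
  assumes K: "compact (UNIV :: 'k set)" and f: "continuous_on UNIV f"
    and T: "finite T" and \<xi>: "\<And>t. t \<in> T \<Longrightarrow> \<xi> t \<in> complex_dual"
  shows "vintegral (atomic_measure T \<xi>) f = (\<Sum>t\<in>T. \<xi> t (f t))"
proof -
  have "has_vintegral (atomic_measure T \<xi>) f (vintegral (atomic_measure T \<xi>) f)"
    using K f atomic_measure_rcabv[OF T \<xi>] by (rule has_vintegral_vintegral)
  then obtain s where s: "\<And>n. simple_function borel (s n)" and lim: "uniform_limit UNIV s f sequentially"
    and int: "(\<lambda>n. simple_vintegral (atomic_measure T \<xi>) (s n)) \<longlonglongrightarrow> vintegral (atomic_measure T \<xi>) f"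
    unfolding has_vintegral_def by blast
  have "(\<lambda>n. \<Sum>t\<in>T. \<xi> t (s n t)) \<longlonglongrightarrow> (\<Sum>t\<in>T. \<xi> t (f t))"
    by (intro tendsto_sum blinfun.tendsto tendsto_const tendsto_uniform_limitI[OF lim]) simp
  then show ?thesis
    using int unfolding simple_vintegral_atomic_measure[OF T s] by (rule LIMSEQ_unique[rotated])
qed

section \<open>Representing functionals by atomic measures\<close>

text \<open>The classical formula \<open>f x = g x - \<i> g (\<i> x)\<close>; rotating \<open>x\<close> so that \<open>f x\<close> becomes real and non-negative
  shows that it does not increase the norm.\<close>

lemma complexify_functional:
  fixes g :: "'x::complex_normed_vector \<Rightarrow>\<^sub>L real"
  obtains f where "f \<in> complex_dual" and "norm f \<le> norm g" and "\<And>x. Re (f x) = g x"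
proof -
  define h where "h x = Complex (g x) (- g (\<i> *\<^sub>C x))" for x
  have "bounded_linear h"
  proof (rule bounded_linear_intro)
    show "h (x + y) = h x + h y" for x y
      by (simp add: h_def scaleC_add_right blinfun.add_right complex_eq_iff)
    have "\<i> *\<^sub>C r *\<^sub>R x = r *\<^sub>R \<i> *\<^sub>C x" for r and x :: 'x
      by (simp add: scaleC_scaleC mult.commute flip: scaleC_of_real)
    then show "h (r *\<^sub>R x) = r *\<^sub>R h x" for r x
      by (simp add: h_def blinfun.scaleR_right complex_eq_iff)
    show "norm (h x) \<le> norm x * (2 * norm g)" for x
      using cmod_le[of "h x"] norm_blinfun[of g x] norm_blinfun[of g "\<i> *\<^sub>C x"]
      by (simp add: h_def norm_scaleC algebra_simps)
  qed
  then have app: "blinfun_apply (Blinfun h) = h"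
    by (rule bounded_linear_Blinfun_apply)
  have scale: "h (c *\<^sub>C x) = c * h x" for c x
  proof -
    have eq: "c *\<^sub>C x = Re c *\<^sub>R x + Im c *\<^sub>R \<i> *\<^sub>C x" for c and x :: 'x
      by (simp add: scaleC_scaleC flip: scaleC_of_real scaleC_add_left)
        (metis complex_eq mult.commute)
    have gc: "g (c *\<^sub>C x) = Re c * g x + Im c * g (\<i> *\<^sub>C x)" for c
      by (subst eq) (simp add: blinfun.add_right blinfun.scaleR_right)
    show ?thesis
      using gc[of c] gc[of "\<i> * c"]
      by (simp add: h_def scaleC_scaleC complex_eq_iff algebra_simps)
  qed
  show ?thesis
  proof (rule that[of "Blinfun h"])
    show "Blinfun h \<in> complex_dual"
      by (simp add: complex_dual_def app scale)
    show "Re (Blinfun h x) = g x" for x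
      by (simp add: app h_def)
    show "norm (Blinfun h) \<le> norm g"
    proof (rule norm_blinfun_bound)
      fix x
      show "cmod (Blinfun h x) \<le> norm g * norm x"
      proof (cases "h x = 0")
        case False
        have "h (cnj (sgn (h x)) *\<^sub>C x) = cmod (h x)"
          using False complex_norm_square[of "h x"]
          by (simp add: scale sgn_div_norm scaleR_conv_of_real field_simps power2_eq_square)
        then have "cmod (h x) = Re (h (cnj (sgn (h x)) *\<^sub>C x))"
          by simp
        also have "\<dots> = g (cnj (sgn (h x)) *\<^sub>C x)"
          by (simp add: h_def)
        also have "\<dots> \<le> norm g * norm (cnj (sgn (h x)) *\<^sub>C x)"
          using norm_blinfun[of g "cnj (sgn (h x)) *\<^sub>C x"] by simp
        finally show ?thesis
          using False by (simp add: app norm_scaleC norm_sgn)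
      qed (simp add: app)
    qed simp
  qed
qed

text \<open>The real representation is applied to the real part of \<open>f\<close>. The hypothesis on \<open>J\<close> makes the range of \<open>L\<close>
  closed under multiplication by \<open>\<i>\<close>, so that equality of real parts on it gives equality of
  imaginary parts.\<close>

theorem atomic_representation:
  fixes L :: "'e::euclidean_space \<Rightarrow> 'k::t2_space \<Rightarrow>\<^sub>C 'x::complex_normed_vector"
  assumes K: "compact (UNIV :: 'k set)" and L: "linear L"
    and J: "\<And>e. L (J e) = \<i> *\<^sub>C L e"
    and f: "f \<in> complex_dual" and le: "\<And>e. cmod (blinfun_apply f (L e)) \<le> R * norm (L e)" and "0 \<le> R"
  obtains T \<xi> where "finite T" and "\<And>t. \<xi> t \<in> complex_dual" and "\<And>t. t \<notin> T \<Longrightarrow> \<xi> t = 0"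
    and "(\<Sum>t\<in>T. norm (\<xi> t)) \<le> R"
    and "\<And>e. (\<Sum>t\<in>T. blinfun_apply (\<xi> t) (apply_bcontfun (L e) t)) = f (L e)"
proof -
  have "linear (\<lambda>e. Re (f (L e)))"
    by (rule linearI)
      (simp_all add: linear_add[OF L] linear_scale[OF L] blinfun.add_right blinfun.scaleR_right)
  moreover have "Re (f (L e)) \<le> R * norm (L e)" for e
    using complex_Re_le_cmod le by (rule order_trans)
  ultimately obtain T and g :: "'k \<Rightarrow> 'x \<Rightarrow>\<^sub>L real" where T: "finite T"
    and g_norm: "(\<Sum>t\<in>T. norm (g t)) \<le> R"
    and g_eq: "\<And>e. (\<Sum>t\<in>T. g t (apply_bcontfun (L e) t)) = Re (f (L e))"
    using finite_combination_of_point_functionals[OF K L _ _ \<open>0 \<le> R\<close>] by blast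
  have "\<exists>h. h \<in> complex_dual \<and> norm h \<le> norm (g t) \<and> (\<forall>x. Re (blinfun_apply h x) = g t x)" for t
    using complexify_functional[of "g t"] by blast
  then obtain h :: "'k \<Rightarrow> 'x \<Rightarrow>\<^sub>L complex" where h: "\<And>t. h t \<in> complex_dual" "\<And>t. norm (h t) \<le> norm (g t)"
    and Re_h: "\<And>t x. Re (h t x) = g t x" by metis
  define \<xi> where "\<xi> t = (if t \<in> T then h t else 0)" for t
  define F where "F e = (\<Sum>t\<in>T. \<xi> t (apply_bcontfun (L e) t))" for e
  have \<xi>: "\<xi> t \<in> complex_dual" for t
    using h(1) by (simp add: \<xi>_def complex_dual_def)
  have Re_F: "Re (F e) = Re (f (L e))" for e
    by (simp add: F_def \<xi>_def Re_h g_eq)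
  have "F (J e) = \<i> * F e" for e
    using \<xi> by (simp add: F_def J apply_bcontfun_scaleC complex_dual_def sum_distrib_left)
  moreover have "f (L (J e)) = \<i> * f (L e)" for e
    using f by (simp add: J complex_dual_def)
  ultimately have Im_F: "Im (F e) = Im (f (L e))" for e
    using Re_F[of "J e"] by simp
  have "(\<Sum>t\<in>T. norm (\<xi> t)) \<le> (\<Sum>t\<in>T. norm (g t))"
    using h(2) by (intro sum_mono) (simp add: \<xi>_def)
  with g_norm have "(\<Sum>t\<in>T. norm (\<xi> t)) \<le> R" by linarith
  with T \<xi> Re_F Im_F show ?thesis
    by (intro that[of T \<xi>]) (auto simp: \<xi>_def F_def complex_eq_iff)
qed

lemma atomic_representation_three:
  fixes f :: "('k::t2_space \<Rightarrow>\<^sub>C 'x::complex_normed_vector) \<Rightarrow>\<^sub>L complex"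
  assumes K: "compact (UNIV :: 'k set)" and f: "f \<in> complex_dual" "norm f \<le> 1"
  shows "\<exists>T \<xi>. finite T \<and> (\<forall>t. \<xi> t \<in> complex_dual) \<and> (\<forall>t. t \<notin> T \<longrightarrow> \<xi> t = 0) \<and>
    (\<Sum>t\<in>T. norm (\<xi> t)) \<le> 1 \<and>
    (\<forall>\<omega>\<in>{\<omega>\<^sub>1, \<omega>\<^sub>2, \<omega>\<^sub>3}. (\<Sum>t\<in>T. blinfun_apply (\<xi> t) (apply_bcontfun \<omega> t)) = f \<omega>)"
proof -
  define L where "L = (\<lambda>(a, b, c). a *\<^sub>C \<omega>\<^sub>1 + b *\<^sub>C \<omega>\<^sub>2 + c *\<^sub>C \<omega>\<^sub>3)"
  have scaleR: "(r *\<^sub>R a) *\<^sub>C \<omega> = r *\<^sub>R a *\<^sub>C \<omega>" for r a and \<omega> :: "'k \<Rightarrow>\<^sub>C 'x"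
    by (simp add: scaleC_scaleC scaleR_conv_of_real flip: scaleC_of_real)
  have "linear L"
    by (rule linearI)
      (auto simp: L_def scaleC_add_left scaleR scaleR_right_distrib)
  moreover have "L (case e of (a, b, c) \<Rightarrow> (\<i> * a, \<i> * b, \<i> * c)) = \<i> *\<^sub>C L e" for e
    by (simp add: L_def scaleC_add_right scaleC_scaleC split: prod.split)
  moreover have "cmod (f (L e)) \<le> 1 * norm (L e)" for e
    using norm_blinfun[of f "L e"] mult_right_mono[OF f(2) norm_ge_zero[of "L e"]] by linarith
  ultimately obtain T \<xi> where *: "finite T" "\<And>t. \<xi> t \<in> complex_dual" "\<And>t. t \<notin> T \<Longrightarrow> \<xi> t = 0"
    "(\<Sum>t\<in>T. norm (\<xi> t)) \<le> 1"
    and eq: "\<And>e. (\<Sum>t\<in>T. blinfun_apply (\<xi> t) (apply_bcontfun (L e) t)) = f (L e)"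
    by (rule atomic_representation[OF K _ _ f(1) _ zero_le_one]) blast
  have "1 *\<^sub>C \<omega> = \<omega>" "0 *\<^sub>C \<omega> = 0" for \<omega> :: "'k \<Rightarrow>\<^sub>C 'x"
    using scaleC_of_real[of 1 \<omega>] scaleC_of_real[of 0 \<omega>] by simp_all
  then have "L (1, 0, 0) = \<omega>\<^sub>1" "L (0, 1, 0) = \<omega>\<^sub>2" "L (0, 0, 1) = \<omega>\<^sub>3"
    by (simp_all add: L_def)
  then have "\<exists>e. \<omega> = L e" if "\<omega> \<in> {\<omega>\<^sub>1, \<omega>\<^sub>2, \<omega>\<^sub>3}" for \<omega>
    using that by (metis empty_iff insert_iff)
  with eq have "(\<Sum>t\<in>T. blinfun_apply (\<xi> t) (apply_bcontfun \<omega> t)) = f \<omega>"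
    if "\<omega> \<in> {\<omega>\<^sub>1, \<omega>\<^sub>2, \<omega>\<^sub>3}" for \<omega>
    using that by blast
  with * show ?thesis by (intro exI[of _ T] exI[of _ \<xi>] conjI allI impI ballI)
qed

text \<open>Along the ray \<open>\<xi> s = \<xi>0 + s (\<xi>1 - \<xi>0)\<close> the integrals of \<open>\<phi>\<close> and \<open>\<psi>\<close> stay fixed, while the variation grows
  continuously from \<open>r < 1\<close> to at least one.\<close>

theorem atomic_representation_norm_one:
  fixes f :: "('k::t2_space \<Rightarrow>\<^sub>C 'x::complex_normed_vector) \<Rightarrow>\<^sub>L complex"
  assumes K: "compact (UNIV :: 'k set)" and f: "f \<in> complex_dual" "norm f = 1"
  shows "\<exists>T \<xi>. finite T \<and> (\<forall>t. \<xi> t \<in> complex_dual) \<and> (\<Sum>t\<in>T. norm (\<xi> t)) = 1 \<and>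
    (\<Sum>t\<in>T. blinfun_apply (\<xi> t) (apply_bcontfun \<phi> t)) = f \<phi> \<and>
    (\<Sum>t\<in>T. blinfun_apply (\<xi> t) (apply_bcontfun \<psi> t)) = f \<psi>"
proof -
  have "norm f \<le> 1" using f(2) by simp
  note represent = atomic_representation_three[OF K f(1) this]
  obtain T0 \<xi>0 where T0: "finite T0" and \<xi>0: "\<forall>t. \<xi>0 t \<in> complex_dual" "\<forall>t. t \<notin> T0 \<longrightarrow> \<xi>0 t = 0"
    and V0: "(\<Sum>t\<in>T0. norm (\<xi>0 t)) \<le> 1"
    and f0: "\<forall>\<omega>\<in>{\<phi>, \<psi>, \<psi>}. (\<Sum>t\<in>T0. blinfun_apply (\<xi>0 t) (apply_bcontfun \<omega> t)) = f \<omega>"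
    using represent[of \<phi> \<psi> \<psi>] by (elim exE conjE) (rule that)
  define r where "r = (\<Sum>t\<in>T0. norm (\<xi>0 t))"
  show ?thesis
  proof (cases "r = 1")
    case True
    then show ?thesis using T0 \<xi>0 f0 by (intro exI[of _ T0] exI[of _ \<xi>0]) (simp add: r_def)
  next
    case False
    with V0 have "r < 1" by (simp add: r_def)
    have "0 \<le> r" by (simp add: r_def sum_nonneg)
    have "\<exists>\<theta>. cmod (f \<theta>) > r * norm \<theta>"
    proof (rule ccontr)
      assume "\<not> ?thesis"
      then have "norm f \<le> r"
        using \<open>0 \<le> r\<close> by (intro norm_blinfun_bound) (auto simp: not_less)
      with \<open>r < 1\<close> f(2) show False by simp
    qed
    then obtain \<theta> where \<theta>: "cmod (f \<theta>) > r * norm \<theta>" by blast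
    obtain T1 \<xi>1 where T1: "finite T1" and \<xi>1: "\<forall>t. \<xi>1 t \<in> complex_dual" "\<forall>t. t \<notin> T1 \<longrightarrow> \<xi>1 t = 0"
    and V1: "(\<Sum>t\<in>T1. norm (\<xi>1 t)) \<le> 1"
    and f1: "\<forall>\<omega>\<in>{\<phi>, \<psi>, \<theta>}. (\<Sum>t\<in>T1. blinfun_apply (\<xi>1 t) (apply_bcontfun \<omega> t)) = f \<omega>"
    using represent[of \<phi> \<psi> \<theta>] by (elim exE conjE) (rule that)
    define T where "T = T0 \<union> T1"
    have T: "finite T" using T0 T1 by (simp add: T_def)
    have sum0: "(\<Sum>t\<in>T. blinfun_apply (\<xi>0 t) (x t)) = (\<Sum>t\<in>T0. blinfun_apply (\<xi>0 t) (x t))" for x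
      using T0 T1 \<xi>0(2) by (intro sum.mono_neutral_right) (auto simp: T_def)
    have sum1: "(\<Sum>t\<in>T. blinfun_apply (\<xi>1 t) (x t)) = (\<Sum>t\<in>T1. blinfun_apply (\<xi>1 t) (x t))" for x
      using T0 T1 \<xi>1(2) by (intro sum.mono_neutral_right) (auto simp: T_def)
    have "cmod (\<Sum>t\<in>T0. \<xi>0 t (apply_bcontfun \<theta> t)) \<le> (\<Sum>t\<in>T0. norm (\<xi>0 t) * norm \<theta>)"
    proof (rule sum_norm_le)
      fix t
      show "cmod (\<xi>0 t (apply_bcontfun \<theta> t)) \<le> norm (\<xi>0 t) * norm \<theta>"
        using norm_blinfun mult_left_mono[OF norm_bounded[of \<theta> t] norm_ge_zero[of "\<xi>0 t"]]
        by (rule order_trans)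
    qed
    also have "\<dots> = r * norm \<theta>" by (simp add: r_def sum_distrib_right)
    finally have "(\<Sum>t\<in>T. \<xi>0 t (apply_bcontfun \<theta> t)) \<noteq> (\<Sum>t\<in>T. \<xi>1 t (apply_bcontfun \<theta> t))"
      using \<theta> f1 by (auto simp: sum0 sum1)
    then obtain t0 where t0: "t0 \<in> T" "\<xi>0 t0 \<noteq> \<xi>1 t0"
      by (metis (no_types, lifting) sum.cong)
    define \<xi> where "\<xi> s t = \<xi>0 t + s *\<^sub>R (\<xi>1 t - \<xi>0 t)" for s t
    define N where "N s = (\<Sum>t\<in>T. norm (\<xi> s t))" for s
    \<comment> \<open>At this parameter the atom at \<open>t0\<close> alone contributes at least one to the variation.\<close>
    define S where "S = (1 + norm (\<xi>0 t0)) / norm (\<xi>1 t0 - \<xi>0 t0)"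
    have "N 0 = r"
      unfolding N_def r_def \<xi>_def
      using T0 T1 \<xi>0(2) by (simp, intro sum.mono_neutral_right) (auto simp: T_def)
    moreover have "1 \<le> N S"
    proof -
      have "norm (S *\<^sub>R (\<xi>1 t0 - \<xi>0 t0)) = 1 + norm (\<xi>0 t0)"
        using t0(2) by (simp add: S_def add_nonneg_nonneg)
      then have "1 \<le> norm (\<xi> S t0)"
        using norm_triangle_ineq4[of "\<xi> S t0" "\<xi>0 t0"] by (simp add: \<xi>_def)
      also have "\<dots> \<le> N S"
        unfolding N_def using t0(1) T by (intro member_le_sum) auto
      finally show ?thesis .
    qed
    moreover have "0 \<le> S" by (simp add: S_def add_nonneg_nonneg)
    moreover have "continuous_on {0..S} N"
      unfolding N_def \<xi>_def by (intro continuous_intros)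
    ultimately obtain s where "N s = 1"
      using IVT'[of N 0 1 S] \<open>r < 1\<close> by auto
    moreover have "\<xi> s t \<in> complex_dual" for t
      using \<xi>0(1)[rule_format, of t] \<xi>1(1)[rule_format, of t]
      by (simp add: \<xi>_def complex_dual_def blinfun.add_left blinfun.diff_left blinfun.scaleR_left algebra_simps scaleR_conv_of_real)
    moreover have "(\<Sum>t\<in>T. \<xi> s t (apply_bcontfun \<omega> t)) = f \<omega>" if "\<omega> = \<phi> \<or> \<omega> = \<psi>" for \<omega>
    proof -
      have "(\<Sum>t\<in>T. \<xi> s t (apply_bcontfun \<omega> t))
          = (\<Sum>t\<in>T. \<xi>0 t (apply_bcontfun \<omega> t))
            + s *\<^sub>R ((\<Sum>t\<in>T. \<xi>1 t (apply_bcontfun \<omega> t)) - (\<Sum>t\<in>T. \<xi>0 t (apply_bcontfun \<omega> t)))"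
        by (simp add: \<xi>_def blinfun.add_left blinfun.diff_left blinfun.scaleR_left
            sum.distrib sum_subtractf flip: scaleR_sum_right)
      also have "\<dots> = f \<omega>"
        using that f0 f1 by (auto simp: sum0 sum1)
      finally show ?thesis .
    qed
    ultimately show ?thesis
      using T by (intro exI[of _ T] exI[of _ "\<xi> s"]) (simp add: N_def)
  qed
qed

section \<open>Approximate orthogonality and measures\<close>

lemma complex_dual_mult:
  fixes f :: "'a::complex_normed_vector \<Rightarrow>\<^sub>L complex"
  assumes f: "f \<in> complex_dual"
  obtains h where "h \<in> complex_dual" and "\<And>x. blinfun_apply h x = c * f x" and "norm h = cmod c * norm f"
proof -
  define h where "h = blinfun_compose (blinfun_mult_right c) f"
  have app: "h x = c * f x" for x
    by (simp add: h_def)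
  have "norm h \<le> cmod c * norm f"
  proof (rule norm_blinfun_bound)
    show "cmod (h x) \<le> cmod c * norm f * norm x" for x
      using mult_left_mono[OF norm_blinfun[of f x] norm_ge_zero[of c]]
      by (simp add: app norm_mult mult.assoc)
  qed simp
  moreover have "cmod c * norm f \<le> norm h"
  proof (cases "c = 0")
    case False
    have "norm f \<le> norm h / cmod c"
    proof (rule norm_blinfun_bound)
      show "cmod (f x) \<le> norm h / cmod c * norm x" for x
        using False norm_blinfun[of h x] by (simp add: app norm_mult field_simps)
    qed simp
    then show ?thesis using False by (simp add: field_simps)
  qed simp
  moreover have "h \<in> complex_dual"
    using f by (simp add: complex_dual_def app)
  ultimately show ?thesis using app by (intro that[of h]) auto
qed

theorem proposition4p2:
  fixes \<phi> \<psi> :: "'k::t2_space \<Rightarrow>\<^sub>C 'x::complex_normed_vector"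
    and \<delta> \<epsilon> :: real
  assumes "compact (UNIV :: 'k set)"
    and "\<phi> \<noteq> 0" and "\<psi> \<noteq> 0"
    and "0 \<le> \<delta>" and "\<delta> < 1"
    and "0 \<le> \<epsilon>" and "\<epsilon> < 1"
    and "\<epsilon> < (1 - \<delta>)^2"
  shows "approx_orthogonal \<delta> \<epsilon> \<phi> \<psi> \<longleftrightarrow>
    {vintegral m (apply_bcontfun \<psi>) | m.
        m \<in> dual_sphere \<and>
        vintegral m (apply_bcontfun \<phi>) \<in> \<real> \<and>
        Re (vintegral m (apply_bcontfun \<phi>)) \<ge> (1 - \<delta>) * norm \<phi>}
      \<inter> cball 0 (\<epsilon> / (1 - \<delta>) * norm \<psi>) \<noteq> {}"
    (is "_ \<longleftrightarrow> ?V \<inter> ?B \<noteq> {}")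
proof
  note K = assms(1)
  assume "approx_orthogonal \<delta> \<epsilon> \<phi> \<psi>"
  then obtain f where f: "f \<in> complex_dual" "f \<noteq> 0"
    and f\<phi>: "cmod (blinfun_apply f \<phi>) \<ge> (1 - \<delta>) * norm f * norm \<phi>"
    and f\<psi>: "cmod (blinfun_apply f \<psi>) \<le> \<epsilon> / (1 - \<delta>) * norm f * norm \<psi>"
    unfolding approx_orthogonal_def by blast
  have "0 < (1 - \<delta>) * norm f * norm \<phi>"
    using f(2) assms by simp
  with f\<phi> have "f \<phi> \<noteq> 0" by auto
  \<comment> \<open>The factor that normalises \<open>f\<close> and makes its value at \<open>\<phi>\<close> non-negative.\<close>
  define c where "c = cnj (sgn (f \<phi>)) / norm f"
  have cmod_c: "cmod c = 1 / norm f"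
    using \<open>f \<phi> \<noteq> 0\<close> f(2) by (simp add: c_def norm_divide norm_sgn)
  obtain h where h: "h \<in> complex_dual" "\<And>x. h x = c * f x" "norm h = 1"
    using complex_dual_mult[OF f(1), of c] f(2) by (auto simp: cmod_c)
  have h\<phi>: "h \<phi> = complex_of_real (cmod (f \<phi>) / norm f)"
    using \<open>f \<phi> \<noteq> 0\<close> f(2) complex_norm_square[of "f \<phi>"]
    by (simp add: h(2) c_def sgn_div_norm scaleR_conv_of_real field_simps power2_eq_square)
  obtain T \<xi> where T: "finite T" and \<xi>: "\<forall>t. \<xi> t \<in> complex_dual" and norm_\<xi>: "(\<Sum>t\<in>T. norm (\<xi> t)) = 1"
    and h_eq: "(\<Sum>t\<in>T. blinfun_apply (\<xi> t) (apply_bcontfun \<phi> t)) = h \<phi>"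
      "(\<Sum>t\<in>T. blinfun_apply (\<xi> t) (apply_bcontfun \<psi> t)) = h \<psi>"
    using atomic_representation_norm_one[where \<phi> = \<phi> and \<psi> = \<psi>, OF K h(1,3)] by (elim exE conjE) (rule that)
  define m where "m = atomic_measure T \<xi>"
  have "m \<in> dual_sphere"
    using atomic_measure_rcabv[OF T, of \<xi>] norm_rcabv_atomic_measure[OF T, of \<xi>] \<xi> norm_\<xi>
    by (simp add: dual_sphere_def m_def)
  have int: "vintegral m (apply_bcontfun \<omega>) = (\<Sum>t\<in>T. \<xi> t (apply_bcontfun \<omega> t))" for \<omega>
    unfolding m_def by (rule vintegral_atomic_measure[OF K _ T]) (simp_all add: \<xi>)
  have int_\<phi>: "vintegral m (apply_bcontfun \<phi>) = complex_of_real (cmod (f \<phi>) / norm f)"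
    unfolding int h_eq by (rule h\<phi>)
  have "(1 - \<delta>) * norm \<phi> \<le> cmod (f \<phi>) / norm f"
    using f\<phi> f(2) by (simp add: field_simps)
  with \<open>m \<in> dual_sphere\<close> have "vintegral m (apply_bcontfun \<psi>) \<in> ?V"
    by (intro CollectI exI[of _ m] conjI refl) (simp_all only: int_\<phi> Reals_of_real Re_complex_of_real)
  moreover have "vintegral m (apply_bcontfun \<psi>) \<in> ?B"
    using f\<psi> f(2) by (simp add: int h_eq h(2) norm_mult cmod_c field_simps)
  ultimately show "?V \<inter> ?B \<noteq> {}" by blast
next
  note K = assms(1)
  assume "?V \<inter> ?B \<noteq> {}"
  then obtain m where m: "m \<in> dual_sphere"
    and m\<phi>: "Re (vintegral m (apply_bcontfun \<phi>)) \<ge> (1 - \<delta>) * norm \<phi>"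
    and m\<psi>: "vintegral m (apply_bcontfun \<psi>) \<in> ?B" by blast
  have mr: "m \<in> rcabv" and "norm_rcabv m = 1"
    using m by (auto simp: dual_sphere_def)
  define f where "f = vintegral_functional m"
  have "norm f = 1"
    using norm_vintegral_functional[OF K mr] \<open>norm_rcabv m = 1\<close> by (simp add: f_def)
  then have "f \<noteq> 0" by auto
  moreover have "f \<in> complex_dual"
    unfolding f_def by (rule vintegral_functional_complex_dual[OF K mr])
  moreover have "(1 - \<delta>) * norm \<phi> \<le> cmod (f \<phi>)"
    using m\<phi> complex_Re_le_cmod unfolding f_def vintegral_functional_apply[OF K mr]
    by (rule order_trans)
  moreover have "cmod (f \<psi>) \<le> \<epsilon> / (1 - \<delta>) * norm \<psi>"
    using m\<psi> by (simp add: f_def vintegral_functional_apply[OF K mr])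
  ultimately show "approx_orthogonal \<delta> \<epsilon> \<phi> \<psi>"
    unfolding approx_orthogonal_def using \<open>norm f = 1\<close> by (intro bexI[of _ f]) auto
qed

end
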